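(* The set $$\mathcal{P}_{\mathrm{cx}}=\bigl\{(A,B)\in\mathcal{C}\times\mathcal{C} : A\le_{\mathrm{cx}} B \text{ or } B\le_{\mathrm{cx}} A\bigr\}$$ is closed and nowhere dense in $(\mathcal{C}\times\mathcal{C},d\times d)$.
   Context: A (bivariate) copula is a function $C:[0,1]^2\to[0,1]$ such that $C(t,0)=C(0,t)=0$ and $C(t,1)=C(1,t)=t$ for all $t\in[0,1]$, and $C(u',v')-C(u,v')-C(u',v)+C(u,v)\ge 0$ whenever $u\le u'$, $v\le v'$ in $[0,1]$. Equivalently, $C$ is the restriction to $[0,1]^2$ of the distribution function of a Borel probability measure on $[0,1]^2$ with both marginals uniform on $[0,1]$; $\int_{[0,1]^2}\varphi\,{\rm d}C$ denotes the integral of $\varphi$ with respect to this measure. $\mathcal{C}$ is the set of all copulas, with the uniform metric $d(A,B)=\sup_{(x,y)\in[0,1]^2}|A(x,y)-B(x,y)|$. The product $\mathcal{C}\times\mathcal{C}$ carries the metric $(d\times d)((A,B),(A',B'))=\max\{d(A,A'),d(B,B')\}$. For $A,B\in\mathcal{C}$, $A\le_{\mathrm{cx}}B$ (convex order) means $\int_{[0,1]^2}\varphi\,{\rm d}A\le\int_{[0,1]^2}\varphi\,{\rm d}B$ for every convex function $\varphi:[0,1]^2\to\mathbb{R}$ (no monotonicity required). A set is nowhere dense if its closure has empty interior. *)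

theory Defs
  imports "HOL-Probability.Probability"
begin

abbreviation unit_square :: "(real \<times> real) set" where
  "unit_square \<equiv> {0..1} \<times> {0..1}"

text \<open>
  A copula is a function whose domain is the unit square. It is represented by a total function
  that is extensional on the square, so that equality of representatives is equality on the
  square and the uniform distance separates points.
\<close>

definition copulas :: "(real \<times> real \<Rightarrow> real) set" where
  "copulas = {C \<in> unit_square \<rightarrow>\<^sub>E {0..1}.
     (\<forall>t\<in>{0..1}. C (t, 0) = 0 \<and> C (0, t) = 0 \<and> C (t, 1) = t \<and> C (1, t) = t) \<and>
     (\<forall>u\<in>{0..1}. \<forall>u'\<in>{0..1}. \<forall>v\<in>{0..1}. \<forall>v'\<in>{0..1}. u \<le> u' \<longrightarrow> v \<le> v' \<longrightarrow>
        C (u', v') - C (u, v') - C (u', v) + C (u, v) \<ge> 0)}"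

text \<open>
  The Borel probability measure on the unit square whose distribution function is \<open>C\<close>.
  For a copula it exists and is unique, and its marginals are uniform because of the
  boundary values of \<open>C\<close>.
\<close>

definition copula_measure :: "(real \<times> real \<Rightarrow> real) \<Rightarrow> (real \<times> real) measure" where
  "copula_measure C = (THE M. prob_space M \<and> sets M = sets (restrict_space borel unit_square) \<and>
     (\<forall>x\<in>{0..1}. \<forall>y\<in>{0..1}. measure M ({0..x} \<times> {0..y}) = C (x, y)))"

text \<open>
  A convex function on the closed unit square is bounded and Borel measurable, also when it is
  discontinuous at the boundary, so both integrals are genuine and no integrability
  hypothesis is needed. Values of \<open>\<phi>\<close> outside the square do not matter.
\<close>

definition cx_le :: "(real \<times> real \<Rightarrow> real) \<Rightarrow> (real \<times> real \<Rightarrow> real) \<Rightarrow> bool"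
    (infix "\<le>\<^sub>c\<^sub>x" 50) where
  "A \<le>\<^sub>c\<^sub>x B \<longleftrightarrow> (\<forall>\<phi>. convex_on unit_square \<phi> \<longrightarrow>
     integral\<^sup>L (copula_measure A) \<phi> \<le> integral\<^sup>L (copula_measure B) \<phi>)"

definition P_cx :: "((real \<times> real \<Rightarrow> real) \<times> (real \<times> real \<Rightarrow> real)) set" where
  "P_cx = {(A, B) \<in> copulas \<times> copulas. A \<le>\<^sub>c\<^sub>x B \<or> B \<le>\<^sub>c\<^sub>x A}"

text \<open>
  The locale \<^locale>\<open>Metric_space\<close> requires symmetry and nonnegativity also off the carrier, where
  the supremum may be taken over an unbounded set; hence the default value there.
\<close>

definition copula_dist :: "(real \<times> real \<Rightarrow> real) \<Rightarrow> (real \<times> real \<Rightarrow> real) \<Rightarrow> real" where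
  "copula_dist A B =
     (if A \<in> copulas \<and> B \<in> copulas then SUP p\<in>unit_square. \<bar>A p - B p\<bar> else 0)"

definition copula_pair_dist ::
    "(real \<times> real \<Rightarrow> real) \<times> (real \<times> real \<Rightarrow> real) \<Rightarrow>
     (real \<times> real \<Rightarrow> real) \<times> (real \<times> real \<Rightarrow> real) \<Rightarrow> real" where
  "copula_pair_dist = (\<lambda>(A, B) (A', B'). max (copula_dist A A') (copula_dist B B'))"

lemma copula_range: "C \<in> copulas \<Longrightarrow> p \<in> unit_square \<Longrightarrow> 0 \<le> C p \<and> C p \<le> 1"
  by (auto simp: copulas_def PiE_iff)

lemma copula_diff_bdd:
  assumes "A \<in> copulas" "B \<in> copulas"
  shows "bdd_above ((\<lambda>p. \<bar>A p - B p\<bar>) ` unit_square)"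
proof (rule bdd_aboveI2)
  fix p assume "p \<in> unit_square"
  then show "\<bar>A p - B p\<bar> \<le> 1"
    using copula_range[OF assms(1), of p] copula_range[OF assms(2), of p] by linarith
qed

lemma copula_dist_upper:
  assumes "A \<in> copulas" "B \<in> copulas" "p \<in> unit_square"
  shows "\<bar>A p - B p\<bar> \<le> copula_dist A B"
  unfolding copula_dist_def using assms cSUP_upper[OF assms(3) copula_diff_bdd] by simp

lemma copula_dist_least:
  assumes "A \<in> copulas" "B \<in> copulas" "\<And>p. p \<in> unit_square \<Longrightarrow> \<bar>A p - B p\<bar> \<le> c"
  shows "copula_dist A B \<le> c"
proof -
  have "unit_square \<noteq> {}" by auto
  then have "(SUP p\<in>unit_square. \<bar>A p - B p\<bar>) \<le> c"
    by (rule cSUP_least) (rule assms(3))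
  with assms(1,2) show ?thesis by (simp add: copula_dist_def)
qed

lemma Metric_space_copulas: "Metric_space copulas copula_dist"
proof
  have origin: "(0, 0) \<in> unit_square" by simp
  show "0 \<le> copula_dist A B" for A B
  proof (cases "A \<in> copulas \<and> B \<in> copulas")
    case True
    then show ?thesis using copula_dist_upper[OF _ _ origin, of A B] by linarith
  qed (auto simp: copula_dist_def)
  show "copula_dist A B = copula_dist B A" for A B
    by (simp add: copula_dist_def abs_minus_commute)
  show "copula_dist A B = 0 \<longleftrightarrow> A = B" if AB: "A \<in> copulas" "B \<in> copulas" for A B
  proof
    assume 0: "copula_dist A B = 0"
    have "A p = B p" if "p \<in> unit_square" for p
      using copula_dist_upper[OF AB that] 0 by simp
    moreover have "A \<in> extensional unit_square" "B \<in> extensional unit_square"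
      using AB by (auto simp: copulas_def PiE_def)
    ultimately show "A = B" by (meson extensionalityI)
  next
    assume "A = B"
    then show "copula_dist A B = 0" by (simp add: copula_dist_def)
  qed
  show "copula_dist A C \<le> copula_dist A B + copula_dist B C"
    if ABC: "A \<in> copulas" "B \<in> copulas" "C \<in> copulas" for A B C
  proof (rule copula_dist_least[OF ABC(1,3)])
    fix p assume p: "p \<in> unit_square"
    show "\<bar>A p - C p\<bar> \<le> copula_dist A B + copula_dist B C"
      using copula_dist_upper[OF ABC(1,2) p] copula_dist_upper[OF ABC(2,3) p] by linarith
  qed
qed

lemma Metric_space_copula_pairs: "Metric_space (copulas \<times> copulas) copula_pair_dist"
proof -
  interpret C: Metric_space copulas copula_dist by (rule Metric_space_copulas)
  show ?thesis
  proof
    show "0 \<le> copula_pair_dist x y" for x y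
      by (auto simp: copula_pair_dist_def le_max_iff_disj split: prod.splits)
    show "copula_pair_dist x y = copula_pair_dist y x" for x y
      by (auto simp: copula_pair_dist_def C.commute split: prod.splits)
    show "copula_pair_dist x y = 0 \<longleftrightarrow> x = y"
      if xy: "x \<in> copulas \<times> copulas" "y \<in> copulas \<times> copulas" for x y
    proof -
      have "max (copula_dist (fst x) (fst y)) (copula_dist (snd x) (snd y)) = 0 \<longleftrightarrow>
          copula_dist (fst x) (fst y) = 0 \<and> copula_dist (snd x) (snd y) = 0"
        using C.nonneg[of "fst x" "fst y"] C.nonneg[of "snd x" "snd y"] by linarith
      with xy show ?thesis by (auto simp: copula_pair_dist_def)
    qed
    show "copula_pair_dist x z \<le> copula_pair_dist x y + copula_pair_dist y z"
      if xyz: "x \<in> copulas \<times> copulas" "y \<in> copulas \<times> copulas" "z \<in> copulas \<times> copulas" for x y z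
    proof -
      have "copula_dist (fst x) (fst z) \<le> copula_dist (fst x) (fst y) + copula_dist (fst y) (fst z)"
        "copula_dist (snd x) (snd z) \<le> copula_dist (snd x) (snd y) + copula_dist (snd y) (snd z)"
        using xyz by (auto intro!: C.triangle)
      then show ?thesis
        by (simp add: copula_pair_dist_def case_prod_unfold max_def)
    qed
  qed
qed

definition copula_pair_topology :: "((real \<times> real \<Rightarrow> real) \<times> (real \<times> real \<Rightarrow> real)) topology" where
  "copula_pair_topology = Metric_space.mtopology (copulas \<times> copulas) copula_pair_dist"

definition nowhere_dense_in :: "'a topology \<Rightarrow> 'a set \<Rightarrow> bool" where
  "nowhere_dense_in X S \<longleftrightarrow> S \<subseteq> topspace X \<and> X interior_of (X closure_of S) = {}"

end

theory Submission
  imports Defs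
begin

text \<open>
  A copula \<open>C\<close> is nondecreasing and 1-Lipschitz in its first argument, so \<open>C(\<cdot>, q)\<close> has a density
  \<open>f\<^sub>q\<close>, and for rational \<open>q\<close> these densities are almost everywhere nondecreasing in \<open>q\<close>: they are
  the conditional distribution functions of \<open>C\<close>. With \<open>T\<close> and \<open>U\<close> independent and uniform, the pair
  \<open>(T, Y)\<close> with \<open>Y = inf {q. U \<le> f\<^sub>q T}\<close> has distribution function \<open>C\<close>, which gives the measure of a
  copula.

  Closedness: for convex \<open>\<phi>\<close> the map \<open>C \<mapsto> \<integral>\<phi> dC\<close> is uniformly continuous. Indeed \<open>\<phi>\<close> is bounded,
  and continuous inside the square, while the uniform marginals bound the mass of a boundary strip
  independently of \<open>C\<close>; on the rest \<open>\<phi>\<close> is uniformly close to a step function on a grid, whose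
  integral is a fixed finite combination of values of \<open>C\<close>.

  Empty interior: \<open>(x - y)\<^sup>2\<close> and \<open>(x + y)\<^sup>2\<close> are convex and their sum has the same integral for all
  copulas, so comparable copulas agree on \<open>\<integral>(x - y)\<^sup>2 dC\<close>. This affine functional is not constant, and
  so mixing a little of a suitable copula into \<open>A\<close> destroys comparability with \<open>B\<close>.
\<close>

subsection \<open>Densities of Stieltjes measures\<close>

text \<open>The sum of the two measures is built as a measure \<open>N\<close> in its own right.
  Both sides assign increments to half-open intervals, which form an intersection-stable generator,
  and the intervals from -i to i exhaust the line with finite mass.\<close>

lemma interval_measure_add:
  fixes F G :: "real \<Rightarrow> real"
  assumes F: "mono F" "continuous_on UNIV F" and G: "mono G" "continuous_on UNIV G"
    and X: "X \<in> sets borel"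
  shows "emeasure (interval_measure (\<lambda>x. F x + G x)) X =
    emeasure (interval_measure F) X + emeasure (interval_measure G) X"
proof -
  let ?\<mu> = "\<lambda>X. emeasure (interval_measure F) X + emeasure (interval_measure G) X"
  define N where "N = measure_of UNIV (sets (borel :: real measure)) ?\<mu>"
  have setsN: "sets N = sets borel"
    unfolding N_def using sets.sigma_sets_eq[of "borel :: real measure"] by simp
  have emN: "emeasure N X = ?\<mu> X" if "X \<in> sets borel" for X
  proof (rule emeasure_measure_of[OF N_def])
    show "X \<in> sets N" using that setsN by simp
    show "positive (sets N) ?\<mu>" by (simp add: positive_def)
    show "countably_additive (sets N) ?\<mu>"
      unfolding countably_additive_def setsN
      by (auto simp: suminf_add[symmetric] suminf_emeasure)
  qed auto
  have Ioc: "emeasure (interval_measure H) {a<..b} = ennreal (H b - H a)"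
    if "mono H" "continuous_on UNIV H" "a \<le> b" for H :: "real \<Rightarrow> real" and a b
    using that by (intro emeasure_interval_measure_Ioc)
      (auto simp: mono_def continuous_on_eq_continuous_within continuous_at_imp_continuous_at_within)
  have "N = interval_measure (\<lambda>x. F x + G x)"
  proof (rule measure_eqI_generator_eq[where \<Omega>=UNIV])
    fix X assume "X \<in> range (\<lambda>(a, b). {a<..b::real})"
    then obtain a b where X: "X = {a<..b}" by auto
    show "emeasure N X = emeasure (interval_measure (\<lambda>x. F x + G x)) X"
    proof (cases "a \<le> b")
      case True
      have "mono (\<lambda>x. F x + G x)"
        using F G by (auto simp: mono_def intro: add_mono)
      moreover have "continuous_on UNIV (\<lambda>x. F x + G x)"
        using F G by (intro continuous_on_add)
      ultimately have "emeasure (interval_measure (\<lambda>x. F x + G x)) X = ennreal (F b + G b - (F a + G a))"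
        using True unfolding X by (rule Ioc)
      also have "\<dots> = ennreal ((F b - F a) + (G b - G a))"
        by (simp add: algebra_simps)
      also have "\<dots> = ennreal (F b - F a) + ennreal (G b - G a)"
        using F G True by (intro ennreal_plus) (auto simp: mono_def)
      also have "\<dots> = ?\<mu> X"
        unfolding X using Ioc[OF F True] Ioc[OF G True] by simp
      finally show ?thesis using emN[of X] by (simp add: X)
    qed (simp add: X)
  next
    show "(\<Union>i. {- real (i::nat)<..real i}) = UNIV"
      by (rule UN_Ioc_eq_UNIV)
  next
    show "emeasure N {- real i<..real i} \<noteq> \<infinity>" for i
      by (subst emN) (auto simp: Ioc F G)
  qed (auto simp: setsN borel_sigma_sets_Ioc Int_stable_def)
  then show ?thesis using emN[OF X] by simp
qed

text \<open>Write \<open>G\<close> as \<open>F\<close> plus the nondecreasing function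
  \<open>G - F\<close>. By additivity the measure of \<open>G\<close> is that of \<open>F\<close>
  plus a nonnegative term.\<close>

lemma interval_measure_mono:
  fixes F G :: "real \<Rightarrow> real"
  assumes F: "mono F" "continuous_on UNIV F" and G: "continuous_on UNIV G"
    and diff: "mono (\<lambda>x. G x - F x)" and X: "X \<in> sets borel"
  shows "emeasure (interval_measure F) X \<le> emeasure (interval_measure G) X"
  using interval_measure_add[OF F diff continuous_on_diff[OF G F(2)] X] by simp

text \<open>Test the hypothesis on the set \<open>S\<close> where \<open>g < f\<close>. There the
  integral of \<open>f - g\<close> is zero although the integrand is positive, so \<open>S\<close>
  is null. Finite total mass makes the subtraction of extended integrals legitimate.\<close>

lemma AE_le_if_density_le:
  fixes f g :: "'a \<Rightarrow> ennreal"
  assumes [measurable]: "f \<in> borel_measurable M" "g \<in> borel_measurable M"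
    and fin: "emeasure (density M f) (space M) < \<infinity>"
    and le: "\<And>X. X \<in> sets M \<Longrightarrow> emeasure (density M f) X \<le> emeasure (density M g) X"
  shows "AE x in M. f x \<le> g x"
proof -
  define S where "S = {x \<in> space M. g x < f x}"
  have S[measurable]: "S \<in> sets M" by (simp add: S_def)
  have "(\<integral>\<^sup>+x. g x * indicator S x \<partial>M) \<le> (\<integral>\<^sup>+x. f x * indicator S x \<partial>M)"
    by (intro nn_integral_mono) (auto simp: S_def indicator_def)
  also have "\<dots> \<le> (\<integral>\<^sup>+x. f x * indicator (space M) x \<partial>M)"
    by (intro nn_integral_mono) (auto simp: S_def indicator_def)
  also have "\<dots> < \<infinity>" using fin by (simp add: emeasure_density)
  finally have gS: "(\<integral>\<^sup>+x. g x * indicator S x \<partial>M) < \<infinity>" .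
  have "(\<integral>\<^sup>+x. f x * indicator S x - g x * indicator S x \<partial>M) =
      (\<integral>\<^sup>+x. f x * indicator S x \<partial>M) - (\<integral>\<^sup>+x. g x * indicator S x \<partial>M)"
    using gS by (intro nn_integral_diff) (auto simp: S_def indicator_def)
  also have "\<dots> = 0"
    using le[OF S] gS by (auto simp: emeasure_density diff_eq_0_iff_ennreal intro: le_less_trans)
  finally have "AE x in M. f x * indicator S x - g x * indicator S x = 0"
    by (subst (asm) nn_integral_0_iff_AE) auto
  with AE_space show ?thesis
    by eventually_elim
       (rule ccontr, auto simp: S_def indicator_def diff_eq_0_iff_ennreal not_le)
qed

text \<open>Lebesgue measure is the interval measure of the identity, so the Lipschitz condition
  \<open>lip\<close> bounds the measure of \<open>F\<close> by it. This gives absolute continuity,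
  and Radon-Nikodym applies.\<close>

lemma interval_measure_density:
  fixes F :: "real \<Rightarrow> real"
  assumes F: "mono F" "continuous_on UNIV F" and lip: "mono (\<lambda>x. x - F x)"
  shows "\<exists>f \<in> borel_measurable borel. density lborel f = interval_measure F"
proof -
  have "emeasure (interval_measure F) X \<le> emeasure lborel X" if "X \<in> sets borel" for X
    unfolding lborel_eq_real using F lip that by (intro interval_measure_mono) auto
  then have "absolutely_continuous lborel (interval_measure F)"
    by (fastforce simp: absolutely_continuous_def null_sets_def)
  from sigma_finite_measure.Radon_Nikodym[OF sigma_finite_lborel this] show ?thesis by simp
qed

subsection \<open>The measure of a copula\<close>

lemma copula_boundary:
  assumes "C \<in> copulas" "t \<in> {0..1}"
  shows "C (t, 0) = 0" "C (0, t) = 0" "C (t, 1) = t" "C (1, t) = t"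
  using assms by (auto simp: copulas_def)

lemma copula_rectangle:
  assumes "C \<in> copulas" "u \<in> {0..1}" "u' \<in> {0..1}" "v \<in> {0..1}" "v' \<in> {0..1}" "u \<le> u'" "v \<le> v'"
  shows "0 \<le> C (u', v') - C (u, v') - C (u', v) + C (u, v)"
  using assms by (auto simp: copulas_def)

text \<open>Apply the rectangle inequality to the strip over \<open>u\<close> to \<open>u'\<close>,
  once below height \<open>v\<close> (monotonicity) and once above it (Lipschitz bound, since
  \<open>C (t, 1) = t\<close>).\<close>

lemma copula_increment_fst:
  assumes C: "C \<in> copulas" and uv: "u \<in> {0..1}" "u' \<in> {0..1}" "v \<in> {0..1}" "u \<le> u'"
  shows "0 \<le> C (u', v) - C (u, v)" "C (u', v) - C (u, v) \<le> u' - u"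
  using copula_rectangle[OF C uv(1,2), of 0 v] copula_rectangle[OF C uv(1,2), of v 1]
    copula_boundary[OF C uv(1)] copula_boundary[OF C uv(2)] uv by auto

lemma copula_increment_snd:
  assumes C: "C \<in> copulas" and uv: "u \<in> {0..1}" "v \<in> {0..1}" "v' \<in> {0..1}" "v \<le> v'"
  shows "0 \<le> C (u, v') - C (u, v)" "C (u, v') - C (u, v) \<le> v' - v"
  using copula_rectangle[OF C _ uv(1), of 0 v v'] copula_rectangle[OF C uv(1), of 1 v v']
    copula_boundary[OF C uv(2)] copula_boundary[OF C uv(3)] uv by auto

section \<open>Sections of a copula on the whole line and their densities\<close>

text \<open>Clamping extends sections of a copula to the whole line, as
  \<open>interval_measure\<close> requires. Later it also forces random points into the square
  everywhere and not only almost everywhere.\<close>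

definition unit_clamp :: "real \<Rightarrow> real" where
  "unit_clamp x = max 0 (min 1 x)"

lemma unit_clamp_in [simp]: "0 \<le> unit_clamp x" "unit_clamp x \<le> 1"
  by (auto simp: unit_clamp_def)

lemma unit_clamp_id [simp]: "0 \<le> x \<Longrightarrow> x \<le> 1 \<Longrightarrow> unit_clamp x = x"
  by (auto simp: unit_clamp_def)

lemma unit_clamp_mono: "x \<le> y \<Longrightarrow> unit_clamp x \<le> unit_clamp y"
  by (auto simp: unit_clamp_def)

lemma unit_clamp_lipschitz: "x \<le> y \<Longrightarrow> unit_clamp y - unit_clamp x \<le> y - x"
  by (auto simp: unit_clamp_def)

lemma continuous_on_unit_clamp: "continuous_on UNIV unit_clamp"
  unfolding unit_clamp_def[abs_def] by (intro continuous_intros)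

lemma borel_measurable_unit_clamp [measurable]: "unit_clamp \<in> borel_measurable borel"
  by (intro borel_measurable_continuous_onI continuous_on_unit_clamp)

lemma copula_section:
  assumes C: "C \<in> copulas" and v: "v \<in> {0..1}"
  defines "F \<equiv> \<lambda>x. C (unit_clamp x, v)"
  shows "mono F" "mono (\<lambda>x. x - F x)" "continuous_on UNIV F"
proof -
  have incr: "0 \<le> F y - F x" "F y - F x \<le> y - x" if "x \<le> y" for x y
    using copula_increment_fst[OF C _ _ v unit_clamp_mono[OF that]] unit_clamp_lipschitz[OF that]
    by (auto simp: F_def)
  show "mono F" "mono (\<lambda>x. x - F x)"
    using incr by (auto simp: mono_def algebra_simps)
  have "1-lipschitz_on UNIV F"
  proof (rule lipschitz_onI)
    show "dist (F x) (F y) \<le> 1 * dist x y" for x y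
      using incr[of x y] incr[of y x] by (cases x y rule: linorder_cases) (auto simp: dist_real_def)
  qed simp
  then show "continuous_on UNIV F" by (rule lipschitz_on_continuous_on)
qed

text \<open>\<open>f q\<close> is the density of the clamped section at height \<open>q\<close>. It
  is at most 1 because sections are 1-Lipschitz, and the rectangle inequality makes differences of
  sections nondecreasing, which orders the densities. Countability of \<open>Q\<close> collects all
  exceptional sets into one null set.\<close>

lemma AE_monotone_densities:
  assumes C: "C \<in> copulas" and Q: "countable Q" "Q \<subseteq> {0..1}"
  obtains f :: "real \<Rightarrow> real \<Rightarrow> ennreal"
  where "\<And>q. q \<in> Q \<Longrightarrow> f q \<in> borel_measurable borel"
    and "\<And>q x. q \<in> Q \<Longrightarrow> x \<in> {0..1} \<Longrightarrow>
      (\<integral>\<^sup>+t. f q t * indicator {0..x} t \<partial>lborel) = ennreal (C (x, q))"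
    and "AE t in lborel. \<forall>q\<in>Q. f q t \<le> 1 \<and> (\<forall>r\<in>Q. q \<le> r \<longrightarrow> f q t \<le> f r t)"
proof -
  define F where "F q x = C (unit_clamp x, q)" for q x
  have sec: "mono (F q)" "mono (\<lambda>x. x - F q x)" "continuous_on UNIV (F q)" if "q \<in> Q" for q
    unfolding F_def using copula_section[OF C, of q] that Q by auto
  have "\<exists>f. f \<in> borel_measurable borel \<and> density lborel f = interval_measure (F q)" if "q \<in> Q" for q
    using interval_measure_density[OF sec(1,3,2)[OF that]] by blast
  then obtain f where f: "f q \<in> borel_measurable borel" "density lborel (f q) = interval_measure (F q)"
    if "q \<in> Q" for q
    by metis
  have meas[measurable]: "f q \<in> borel_measurable borel" if "q \<in> Q" for q
    using f that by auto
  have int: "(\<integral>\<^sup>+t. f q t * indicator {a..b} t \<partial>lborel) = ennreal (F q b - F q a)"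
    if "q \<in> Q" "a \<le> b" for q a b
  proof -
    have "(\<integral>\<^sup>+t. f q t * indicator {a..b} t \<partial>lborel) = emeasure (density lborel (f q)) {a..b}"
      using that by (subst emeasure_density) auto
    also have "\<dots> = ennreal (F q b - F q a)"
      unfolding f(2)[OF that(1)] using sec[OF that(1)] that
      by (intro emeasure_interval_measure_Icc) (auto simp: mono_def)
    finally show ?thesis .
  qed
  have fin: "emeasure (density lborel (f q)) (space lborel) < \<infinity>" if q: "q \<in> Q" for q
  proof -
    have mono: "F q x \<le> F q y" if "x \<le> y" for x y
      using sec(1)[OF q] that by (auto simp: mono_def)
    have F0: "F q x = 0" if "x \<le> 0" for x
      using copula_boundary[OF C, of q] q Q that by (auto simp: F_def unit_clamp_def)
    have F1: "F q x = q" if "1 \<le> x" for x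
      using copula_boundary[OF C, of q] q Q that by (auto simp: F_def unit_clamp_def)
    have "(F q \<longlongrightarrow> 0) at_bot"
      by (rule tendsto_eventually) (auto simp: F0 intro: eventually_mono[OF eventually_le_at_bot[of 0]])
    moreover have "(F q \<longlongrightarrow> q) at_top"
      by (rule tendsto_eventually) (auto simp: F1 intro: eventually_mono[OF eventually_ge_at_top[of 1]])
    moreover have "continuous (at_right a) (F q)" for a
      using sec(3)[OF q] by (auto simp: continuous_on_eq_continuous_within continuous_at_imp_continuous_at_within)
    \<comment> \<open>The clamped section is 0 to the left of 0 and \<open>q\<close> to the right of
      1, so the total mass is \<open>q\<close>.\<close>
    ultimately have "emeasure (interval_measure (F q)) UNIV = q"
      using q Q by (intro interval_measure_UNIV[OF mono]) auto
    then show ?thesis using f[OF q] by simp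
  qed
  have le1: "AE t in lborel. f q t \<le> 1" if q: "q \<in> Q" for q
  proof (rule AE_le_if_density_le[OF _ _ fin[OF q]])
    fix X :: "real set" assume "X \<in> sets lborel"
    then show "emeasure (density lborel (f q)) X \<le> emeasure (density lborel (\<lambda>_. 1)) X"
      unfolding f(2)[OF q] density_1 unfolding lborel_eq_real
      using sec[OF q] by (intro interval_measure_mono) auto
  qed (use f q in auto)
  have mono: "AE t in lborel. f q t \<le> f r t" if q: "q \<in> Q" and r: "r \<in> Q" and "q \<le> r" for q r
  proof (rule AE_le_if_density_le[OF _ _ fin[OF q]])
    fix X :: "real set" assume X: "X \<in> sets lborel"
    have "mono (\<lambda>x. F r x - F q x)"
    proof (rule monoI)
      fix x y :: real assume "x \<le> y"
      then show "F r x - F q x \<le> F r y - F q y"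
        using copula_rectangle[OF C, of "unit_clamp x" "unit_clamp y" q r] q r \<open>q \<le> r\<close> subsetD[OF Q(2)]
        by (auto simp: F_def unit_clamp_mono algebra_simps)
    qed
    then show "emeasure (density lborel (f q)) X \<le> emeasure (density lborel (f r)) X"
      unfolding f(2)[OF q] f(2)[OF r]
      using sec[OF q] sec[OF r] X by (intro interval_measure_mono) auto
  qed (use f q r in auto)
  have "AE t in lborel. f q t \<le> 1 \<and> (\<forall>r\<in>Q. q \<le> r \<longrightarrow> f q t \<le> f r t)" if "q \<in> Q" for q
    using le1[OF that] mono[OF that] Q by (intro AE_conjI AE_ball_countable') (auto intro: AE_impI)
  then have "AE t in lborel. \<forall>q\<in>Q. f q t \<le> 1 \<and> (\<forall>r\<in>Q. q \<le> r \<longrightarrow> f q t \<le> f r t)"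
    using Q by (intro AE_ball_countable') auto
  moreover have "(\<integral>\<^sup>+t. f q t * indicator {0..x} t \<partial>lborel) = ennreal (C (x, q))"
    if "q \<in> Q" "x \<in> {0..1}" for q x
    using int[OF that(1), of 0 x] that copula_boundary[OF C, of q] Q by (auto simp: F_def)
  ultimately show thesis using that meas by blast
qed

section \<open>The uniform distribution on the unit interval\<close>

abbreviation unit_uniform :: "real measure" where
  "unit_uniform \<equiv> uniform_measure lborel {0..1}"

lemma prob_space_unit_uniform: "prob_space unit_uniform"
  by (rule prob_space_uniform_measure) auto

lemma nn_integral_unit_uniform:
  assumes "g \<in> borel_measurable borel"
  shows "(\<integral>\<^sup>+x. g x \<partial>unit_uniform) = (\<integral>\<^sup>+x. g x * indicator {0..1} x \<partial>lborel)"
  using assms by (simp add: nn_integral_uniform_measure divide_ennreal_def)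

lemma emeasure_unit_uniform:
  assumes "X \<in> sets borel"
  shows "emeasure unit_uniform X = emeasure lborel ({0..1} \<inter> X)"
  using assms by (simp add: emeasure_uniform_measure divide_ennreal_def)

text \<open>Used with \<open>c\<close> equal to \<open>f q t\<close>: the auxiliary uniform
  coordinate turns a conditional probability into an event. Negative \<open>u\<close> satisfy the
  inequality too, but carry no mass.\<close>

lemma emeasure_unit_uniform_le:
  assumes "c \<le> 1"
  shows "emeasure unit_uniform {u. ennreal u \<le> c} = c"
proof (cases c)
  case (real r)
  have "{0..1} \<inter> {u. ennreal u \<le> c} = {0..r}"
    using real assms by (auto simp: ennreal_le_iff)
  moreover have "{u. ennreal u \<le> c} \<in> sets borel" by measurable
  ultimately show ?thesis using real
    by (simp add: emeasure_unit_uniform del: emeasure_uniform_measure)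
qed (use assms in \<open>auto simp: top_unique\<close>)

lemma AE_unit_uniform: "AE x in unit_uniform. x \<in> {0..1}"
  by (rule AE_uniform_measureI) auto

text \<open>This is the predicate inside the description that defines \<open>copula_measure\<close>,
  named so that existence and uniqueness can be treated separately.\<close>

definition represents_copula :: "(real \<times> real) measure \<Rightarrow> (real \<times> real \<Rightarrow> real) \<Rightarrow> bool" where
  "represents_copula M C \<longleftrightarrow> prob_space M \<and> sets M = sets (restrict_space borel unit_square) \<and>
     (\<forall>x\<in>{0..1}. \<forall>y\<in>{0..1}. measure M ({0..x} \<times> {0..y}) = C (x, y))"

text \<open>Conditional quantile construction: given the first coordinate, \<open>Y\<close> is a
  generalized inverse of the conditional distribution function, evaluated at an independent uniform
  variable. The event \<open>Y \<le> y\<close> is squeezed between events at rational levels below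
  and above \<open>y\<close>, and the Lipschitz bound in the second argument closes the gap.\<close>

lemma ex_represents_copula:
  assumes C: "C \<in> copulas"
  shows "\<exists>M. represents_copula M C"
proof -
  define Q where "Q = \<rat> \<inter> {0..1::real}"
  have Q: "countable Q" "Q \<subseteq> {0..1}" "0 \<in> Q" "1 \<in> Q"
    by (auto simp: Q_def countable_rat)
  obtain f :: "real \<Rightarrow> real \<Rightarrow> ennreal"
    where meas: "\<And>q. q \<in> Q \<Longrightarrow> f q \<in> borel_measurable borel"
    and int: "\<And>q x. q \<in> Q \<Longrightarrow> x \<in> {0..1} \<Longrightarrow>
      (\<integral>\<^sup>+t. f q t * indicator {0..x} t \<partial>lborel) = ennreal (C (x, q))"
    and good_lborel: "AE t in lborel. \<forall>q\<in>Q. f q t \<le> 1 \<and> (\<forall>r\<in>Q. q \<le> r \<longrightarrow> f q t \<le> f r t)"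
    by (rule AE_monotone_densities[OF C Q(1,2)]) blast
  \<comment> \<open>The first coordinates at which all countably many density inequalities hold;
    almost every point is of this kind.\<close>
  define good where "good t \<longleftrightarrow> t \<in> {0..1} \<and> (\<forall>q\<in>Q. f q t \<le> 1 \<and> (\<forall>r\<in>Q. q \<le> r \<longrightarrow> f q t \<le> f r t))" for t
  interpret P: prob_space unit_uniform by (rule prob_space_unit_uniform)
  interpret PP: pair_prob_space unit_uniform unit_uniform ..
  let ?PP = "unit_uniform \<Otimes>\<^sub>M unit_uniform"
  have good: "AE t in unit_uniform. good t"
  proof -
    have "AE t in unit_uniform. \<forall>q\<in>Q. f q t \<le> 1 \<and> (\<forall>r\<in>Q. q \<le> r \<longrightarrow> f q t \<le> f r t)"
      using good_lborel by (intro AE_uniform_measureI) auto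
    with AE_unit_uniform show ?thesis by eventually_elim (simp add: good_def)
  qed
  have good_fst: "AE p in ?PP. good (fst p)"
  proof (rule AE_distrD[of fst ?PP unit_uniform good])
    show "fst \<in> measurable ?PP unit_uniform" by (rule measurable_fst)
    show "AE t in distr ?PP unit_uniform fst. good t"
      unfolding prob_space.distr_pair_fst[OF prob_space_unit_uniform] by (rule good)
  qed
  \<comment> \<open>Levels that fail the test contribute the default 1, so the infimum always ranges
    over a nonempty family in \<open>[0,1]\<close>.\<close>
  define Y where "Y p = (INF q\<in>Q. if ennreal (snd p) \<le> f q (fst p) then q else 1)" for p
  have bdd: "bdd_below ((\<lambda>q. if ennreal (snd p) \<le> f q (fst p) then q else 1) ` Q)" for p
    using Q by (intro bdd_belowI[of _ 0]) (auto simp: Q_def)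
  have Y01: "0 \<le> Y p" "Y p \<le> 1" for p
  proof -
    show "0 \<le> Y p" unfolding Y_def using Q by (intro cINF_greatest) (auto simp: Q_def)
    have "Y p \<le> (if ennreal (snd p) \<le> f 1 (fst p) then 1 else 1)"
      unfolding Y_def using Q by (intro cINF_lower2[OF bdd]) auto
    then show "Y p \<le> 1" by simp
  qed
  have Y_le: "Y p \<le> q" if "q \<in> Q" "ennreal (snd p) \<le> f q (fst p)" for p q
    unfolding Y_def using that by (intro cINF_lower2[OF bdd that(1)]) auto
  \<comment> \<open>The infimum need not be attained, so a strict inequality is required. Some level
    below \<open>r\<close> passes the test, and monotonicity at a good point passes it on to
    \<open>r\<close>.\<close>
  have Y_less: "ennreal (snd p) \<le> f r (fst p)" if "Y p < r" "r \<in> Q" "good (fst p)" for p r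
  proof -
    have "Q \<noteq> {}" using Q by auto
    from cINF_less_iff[OF this bdd[of p], of r] that(1)
    obtain q where q: "q \<in> Q" "(if ennreal (snd p) \<le> f q (fst p) then q else 1) < r"
      by (auto simp: Y_def)
    \<comment> \<open>A term below \<open>r \<le> 1\<close> cannot be the default value 1.\<close>
    moreover have "r \<le> 1" using that Q by auto
    ultimately have "ennreal (snd p) \<le> f q (fst p)" "q \<le> r" by (auto split: if_splits)
    then show ?thesis using that q by (auto simp: good_def intro: order_trans)
  qed
  note [measurable] = meas
  have [measurable]: "Y \<in> borel_measurable ?PP"
    unfolding Y_def[abs_def] using Q by (intro borel_measurable_cINF_real) auto
  \<comment> \<open>\<open>D y x\<close> is the event that the constructed point lies in the
    rectangle with corner \<open>(x, y)\<close>; \<open>E q x\<close> is its approximation at level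
    \<open>q\<close>, whose probability follows by integrating over the first coordinate.\<close>
  define E where "E q x = {p. fst p \<le> x \<and> ennreal (snd p) \<le> f q (fst p)}" for q x
  define D where "D y x = {p. unit_clamp (fst p) \<le> x \<and> Y p \<le> y}" for y x
  have E_sets: "E q x \<in> sets ?PP" if [measurable]: "q \<in> Q" for q x
  proof -
    have "{p \<in> space ?PP. fst p \<le> x \<and> ennreal (snd p) \<le> f q (fst p)} \<in> sets ?PP" by measurable
    then show ?thesis by (simp add: E_def space_pair_measure)
  qed
  have D_sets: "D y x \<in> sets ?PP" for y x
  proof -
    have "{p \<in> space ?PP. unit_clamp (fst p) \<le> x \<and> Y p \<le> y} \<in> sets ?PP" by measurable
    then show ?thesis by (simp add: D_def space_pair_measure)
  qed
  have E: "emeasure ?PP (E q x) = ennreal (C (x, q))" if q[measurable]: "q \<in> Q" and x: "x \<in> {0..1}" for q x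
  proof -
    have "emeasure ?PP (E q x) = (\<integral>\<^sup>+t. emeasure unit_uniform (Pair t -` E q x) \<partial>unit_uniform)"
      by (intro P.emeasure_pair_measure_alt E_sets q)
    also have "\<dots> = (\<integral>\<^sup>+t. f q t * indicator {..x} t \<partial>unit_uniform)"
    proof (rule nn_integral_cong_AE, use good in eventually_elim)
      fix t assume "good t"
      then have "f q t \<le> 1" using q by (auto simp: good_def)
      moreover have "Pair t -` E q x = (if t \<le> x then {u. ennreal u \<le> f q t} else {})"
        by (auto simp: E_def)
      ultimately show "emeasure unit_uniform (Pair t -` E q x) = f q t * indicator {..x} t"
        using emeasure_unit_uniform_le[of "f q t"] by (simp add: indicator_def)
    qed
    also have "\<dots> = (\<integral>\<^sup>+t. f q t * indicator {..x} t * indicator {0..1} t \<partial>lborel)"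
      by (rule nn_integral_unit_uniform) measurable
    also have "\<dots> = (\<integral>\<^sup>+t. f q t * indicator {0..x} t \<partial>lborel)"
      using x by (intro nn_integral_cong) (auto simp: indicator_def)
    also have "\<dots> = ennreal (C (x, q))" by (rule int[OF q x])
    finally show ?thesis .
  qed
  have D: "PP.P.prob (D y x) = C (x, y)" if x: "x \<in> {0..1}" and y: "y \<in> {0..1}" for x y
  proof (rule antisym)
    have lower: "C (x, q) \<le> PP.P.prob (D y x)" if "q \<in> Q" "q \<le> y" for q
    proof -
      have "AE p in ?PP. p \<in> E q x \<longrightarrow> p \<in> D y x"
        using good_fst by eventually_elim
          (use that Y_le in \<open>auto simp: E_def D_def good_def intro: order_trans\<close>)
      then have "emeasure ?PP (E q x) \<le> emeasure ?PP (D y x)"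
        by (rule emeasure_mono_AE[OF _ D_sets])
      then show ?thesis
        unfolding E[OF that(1) x] unfolding PP.P.emeasure_eq_measure by simp
    qed
    show "C (x, y) \<le> PP.P.prob (D y x)"
    proof (rule field_le_epsilon)
      fix e :: real assume e: "0 < e"
      obtain q where q: "q \<in> Q" "q \<le> y" "y - q \<le> e"
      proof (cases "y = 0")
        \<comment> \<open>Here \<open>Q\<close> has no level below \<open>y\<close>, but
          \<open>y = 0\<close> is itself a level.\<close>
        case True then show thesis using that[of 0] Q e by auto
      next
        case False
        then have "max 0 (y - e) < y" using y e by auto
        from Rats_dense_in_real[OF this] obtain r where "r \<in> \<rat>" "max 0 (y - e) < r" "r < y"
          by blast
        then show thesis using that[of r] y by (auto simp: Q_def)
      qed
      have "C (x, y) - C (x, q) \<le> y - q"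
        using q Q y x by (intro copula_increment_snd[OF C]) auto
      then show "C (x, y) \<le> PP.P.prob (D y x) + e" using lower[OF q(1,2)] q(3) by linarith
    qed
    have D_fst: "AE p in ?PP. p \<in> D y x \<longrightarrow> fst p \<le> x"
      using good_fst by eventually_elim (auto simp: D_def good_def)
    have upper: "PP.P.prob (D y x) \<le> C (x, r)" if "r \<in> Q" "y < r" for r
    proof -
      have "AE p in ?PP. p \<in> D y x \<longrightarrow> p \<in> E r x"
        using good_fst D_fst
      proof eventually_elim
        case (elim p)
        then show ?case using Y_less[of p r] that by (auto simp: D_def E_def)
      qed
      then have "emeasure ?PP (D y x) \<le> emeasure ?PP (E r x)"
        by (rule emeasure_mono_AE[OF _ E_sets[OF that(1)]])
      then show ?thesis
        unfolding E[OF that(1) x] unfolding PP.P.emeasure_eq_measure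
        using copula_range[OF C, of "(x, r)"] x Q(2) that(1) by (auto simp: ennreal_le_iff)
    qed
    show "PP.P.prob (D y x) \<le> C (x, y)"
    \<comment> \<open>No level of \<open>Q\<close> lies above 1, so this case uses the law of the
      first coordinate and \<open>C (x, 1) = x\<close> instead.\<close>
    proof (cases "y = 1")
      case True
      have "AE p in ?PP. p \<in> D y x \<longrightarrow> p \<in> {..x} \<times> UNIV"
        using D_fst by eventually_elim auto
      then have "emeasure ?PP (D y x) \<le> emeasure ?PP ({..x} \<times> UNIV)"
        by (rule emeasure_mono_AE) auto
      also have "\<dots> = emeasure unit_uniform {..x} * emeasure unit_uniform UNIV"
        by (intro P.emeasure_pair_measure_Times) auto
      also have "\<dots> = emeasure unit_uniform {..x}"
        using P.emeasure_space_1 by simp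
      also have "\<dots> = emeasure lborel ({0..1} \<inter> {..x})"
        by (rule emeasure_unit_uniform) simp
      also have "{0..1} \<inter> {..x} = {0..x}" using x by auto
      finally show ?thesis
        using x True copula_boundary[OF C x] by (simp add: PP.P.emeasure_eq_measure)
    next
      case False
      show ?thesis
      proof (rule field_le_epsilon)
        fix e :: real assume e: "0 < e"
        have "y < min 1 (y + e)" using y e False by auto
        from Rats_dense_in_real[OF this] obtain r where "r \<in> \<rat>" "y < r" "r < min 1 (y + e)"
          by blast
        then have r: "r \<in> Q" "y < r" "r - y \<le> e" using y by (auto simp: Q_def)
        have "C (x, r) - C (x, y) \<le> r - y"
          using r Q y x by (intro copula_increment_snd[OF C]) auto
        then show "PP.P.prob (D y x) \<le> C (x, y) + e" using upper[OF r(1,2)] r(3) by linarith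
      qed
    qed
  qed
  define T where "T p = (unit_clamp (fst p), Y p)" for p
  have [measurable]: "T \<in> measurable ?PP (restrict_space borel unit_square)"
  proof (rule measurable_restrict_space2)
    show "T \<in> space ?PP \<rightarrow> unit_square" by (auto simp: T_def Y01)
    show "T \<in> borel_measurable ?PP" unfolding T_def[abs_def] by measurable
  qed
  have "measure (distr ?PP (restrict_space borel unit_square) T) ({0..x} \<times> {0..y}) = C (x, y)"
    if "x \<in> {0..1}" "y \<in> {0..1}" for x y
  proof -
    have "{0..x} \<times> {0..y} \<in> sets (restrict_space borel unit_square)"
      using that by (subst sets_restrict_space_iff) (auto intro!: borel_Times)
    moreover have "T -` ({0..x} \<times> {0..y}) \<inter> space ?PP = D y x"
      by (auto simp: T_def D_def Y01 space_pair_measure)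
    ultimately show ?thesis using D[OF that] by (simp add: measure_distr)
  qed
  then have "represents_copula (distr ?PP (restrict_space borel unit_square) T) C"
    by (auto simp: represents_copula_def intro!: PP.P.prob_space_distr)
  then show ?thesis ..
qed

text \<open>Push both measures to the plane. A lower-left quadrant meets the square in the empty set
  or in a rectangle anchored at the origin, where \<open>C\<close> fixes the mass. Quadrants form an
  intersection-stable generator of the Borel sets, and every measurable subset of the square is the
  trace of a Borel set.\<close>

lemma represents_copula_unique:
  assumes "represents_copula M C" "represents_copula N C"
  shows "M = N"
proof -
  let ?S = "restrict_space borel unit_square :: (real \<times> real) measure"
  have sets: "sets M = sets ?S" "sets N = sets ?S"
    using assms by (auto simp: represents_copula_def)
  interpret M: prob_space M using assms by (simp add: represents_copula_def)
  interpret N: prob_space N using assms by (simp add: represents_copula_def)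
  have id: "(\<lambda>p. p) \<in> measurable ?S borel"
    by (rule measurable_restrict_space1) simp
  have idM: "(\<lambda>p. p) \<in> measurable M borel" and idN: "(\<lambda>p. p) \<in> measurable N borel"
    using id measurable_cong_sets[OF sets(1) refl] measurable_cong_sets[OF sets(2) refl] by auto
  have space: "space M = unit_square" "space N = unit_square"
    using sets_eq_imp_space_eq[OF sets(1)] sets_eq_imp_space_eq[OF sets(2)] by (auto simp: space_restrict_space)
  let ?M = "distr M borel (\<lambda>p. p)" and ?N = "distr N borel (\<lambda>p. p)"
  have quadrant: "emeasure M ({..(a, b)} \<inter> unit_square) = emeasure N ({..(a, b)} \<inter> unit_square)" for a b :: real
  proof (cases "0 \<le> a \<and> 0 \<le> b")
    case True
    then have "{..(a, b)} \<inter> unit_square = {0..unit_clamp a} \<times> {0..unit_clamp b}"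
      by (auto simp: unit_clamp_def)
    moreover have "measure M ({0..unit_clamp a} \<times> {0..unit_clamp b}) =
        measure N ({0..unit_clamp a} \<times> {0..unit_clamp b})"
      using assms by (simp add: represents_copula_def)
    ultimately show ?thesis by (simp add: M.emeasure_eq_measure N.emeasure_eq_measure)
  next
    case False
    then have "{..(a, b)} \<inter> unit_square = {}" by auto
    then show ?thesis by simp
  qed
  have "?M = ?N"
  proof (rule measure_eqI_generator_eq[where \<Omega>=UNIV and E="range (\<lambda>a. {..a})" and A="\<lambda>n. {..(real n, real n)}"])
    show "Int_stable (range (\<lambda>a::real \<times> real. {..a}))"
    proof (rule Int_stableI_image)
      show "\<exists>c\<in>UNIV. {..a} \<inter> {..b} = {..c}" for a b :: "real \<times> real"
        by (intro bexI[of _ "(min (fst a) (fst b), min (snd a) (snd b))"]) (auto simp: less_eq_prod_def)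
    qed
    show "emeasure ?M X = emeasure ?N X" if "X \<in> range (\<lambda>a. {..a})" for X
    proof -
      from that obtain p where "X = {..p}" by blast
      then obtain a b where X: "X = {..(a, b)}" by (cases p) blast
      show ?thesis
        unfolding X using quadrant[of a b] by (simp add: emeasure_distr idM idN space)
    qed
    have "sigma_sets UNIV (range (\<lambda>a::real \<times> real. {..a})) = sets borel"
      by (subst borel_eq_atMost) simp
    then show "sets ?M = sigma_sets UNIV (range (\<lambda>a. {..a}))" "sets ?N = sigma_sets UNIV (range (\<lambda>a. {..a}))"
      by auto
    show "(\<Union>n. {..(real n, real n)}) = UNIV"
    proof safe
      fix a b :: real
      obtain n where "max a b \<le> real n" using real_arch_simple by blast
      then show "(a, b) \<in> (\<Union>n. {..(real n, real n)})" by auto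
    qed simp
    show "emeasure ?M {..(real n, real n)} \<noteq> \<infinity>" for n
      by (simp add: emeasure_distr idM)
  qed auto
  show "M = N"
  proof (rule measure_eqI)
    fix X assume "X \<in> sets M"
    then obtain X' where X': "X' \<in> sets borel" "X = X' \<inter> unit_square"
      unfolding sets by (auto simp: sets_restrict_space)
    have "emeasure ?M X' = emeasure ?N X'" by (simp add: \<open>?M = ?N\<close>)
    then show "emeasure M X = emeasure N X"
      using X' by (simp add: emeasure_distr idM idN space)
  qed (simp add: sets)
qed

section \<open>Basic properties of \<open>copula_measure\<close>\<close>

lemma copula_measure_eqI: "represents_copula M C \<Longrightarrow> copula_measure C = M"
  unfolding copula_measure_def represents_copula_def[symmetric]
  by (rule the_equality) (auto intro: represents_copula_unique)

lemma represents_copula_measure: "C \<in> copulas \<Longrightarrow> represents_copula (copula_measure C) C"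
  using ex_represents_copula copula_measure_eqI by metis

lemma prob_space_copula_measure: "C \<in> copulas \<Longrightarrow> prob_space (copula_measure C)"
  and sets_copula_measure: "C \<in> copulas \<Longrightarrow> sets (copula_measure C) = sets (restrict_space borel unit_square)"
  and measure_copula_measure: "C \<in> copulas \<Longrightarrow> x \<in> {0..1} \<Longrightarrow> y \<in> {0..1} \<Longrightarrow>
    measure (copula_measure C) ({0..x} \<times> {0..y}) = C (x, y)"
  using represents_copula_measure by (auto simp: represents_copula_def)

lemma space_copula_measure: "C \<in> copulas \<Longrightarrow> space (copula_measure C) = unit_square"
  using sets_eq_imp_space_eq[OF sets_copula_measure] by (simp add: space_restrict_space)

lemma borel_measurable_copula_measure:
  assumes "C \<in> copulas"
  shows "borel_measurable (copula_measure C) = borel_measurable (restrict_space borel unit_square)"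
  by (rule measurable_cong_sets[OF sets_copula_measure[OF assms] refl])

lemma copula_sets:
  assumes C: "C \<in> copulas" and "X \<in> sets borel" "Y \<in> sets borel" "X \<subseteq> {0..1}" "Y \<subseteq> {0..1}"
  shows "X \<times> Y \<in> sets (copula_measure C)"
  using assms
  by (subst sets_copula_measure[OF C], subst sets_restrict_space_iff) (auto intro!: borel_Times)

text \<open>Inclusion-exclusion from anchored rectangles, one coordinate at a time. Half-open
  rectangles are used because they tile a grid without overlap.\<close>

lemma measure_copula_rectangle:
  assumes C: "C \<in> copulas" and ab: "0 \<le> a" "a \<le> b" "b \<le> 1" and cd: "0 \<le> c" "c \<le> d" "d \<le> 1"
  shows "measure (copula_measure C) ({a<..b} \<times> {c<..d}) = C (b, d) - C (a, d) - C (b, c) + C (a, c)"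
proof -
  interpret prob_space "copula_measure C" by (rule prob_space_copula_measure[OF C])
  have strip: "prob ({a<..b} \<times> {0..y}) = C (b, y) - C (a, y)" if y: "0 \<le> y" "y \<le> 1" for y
  proof -
    have "{a<..b} \<times> {0..y} = {0..b} \<times> {0..y} - {0..a} \<times> {0..y}" using ab by auto
    moreover have "prob ({0..b} \<times> {0..y} - {0..a} \<times> {0..y}) =
        prob ({0..b} \<times> {0..y}) - prob ({0..a} \<times> {0..y})"
      using ab y by (intro finite_measure_Diff copula_sets[OF C]) auto
    ultimately show ?thesis using ab y by (simp add: measure_copula_measure[OF C])
  qed
  have "{a<..b} \<times> {c<..d} = {a<..b} \<times> {0..d} - {a<..b} \<times> {0..c}" using cd by auto
  moreover have "prob ({a<..b} \<times> {0..d} - {a<..b} \<times> {0..c}) =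
      prob ({a<..b} \<times> {0..d}) - prob ({a<..b} \<times> {0..c})"
    using ab cd by (intro finite_measure_Diff copula_sets[OF C]) auto
  ultimately show ?thesis using strip[of c] strip[of d] cd by simp
qed

subsection \<open>Continuity of integrals of convex functions\<close>

text \<open>The index is the ceiling of \<open>(x - a) / h\<close>, minus one because cells are
  numbered from 0. The equivalence records uniqueness, so that exactly one cell indicator survives
  in a sum.\<close>

lemma ex_grid_index:
  fixes a h x :: real
  assumes h: "0 < h" and x: "a < x" "x \<le> a + real N * h"
  shows "\<exists>i<N. \<forall>k. x \<in> {a + real k * h<..a + real (Suc k) * h} \<longleftrightarrow> k = i"
proof -
  define c where "c = \<lceil>(x - a) / h\<rceil>"
  have "0 < (x - a) / h" "(x - a) / h \<le> real N" using h x by (auto simp: field_simps)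
  then have c: "1 \<le> c" "c \<le> int N" unfolding c_def by (auto simp: ceiling_le_iff int_one_le_iff_zero_less)
  have "x \<in> {a + real k * h<..a + real (Suc k) * h} \<longleftrightarrow> k = nat (c - 1)" for k
  proof -
    have "x \<in> {a + real k * h<..a + real (Suc k) * h} \<longleftrightarrow>
        of_int (int k + 1) - 1 < (x - a) / h \<and> (x - a) / h \<le> of_int (int k + 1)"
      using h by (auto simp: field_simps)
    also have "\<dots> \<longleftrightarrow> c = int k + 1" unfolding c_def by (rule ceiling_eq_iff[symmetric])
    also have "\<dots> \<longleftrightarrow> k = nat (c - 1)" using c by auto
    finally show ?thesis .
  qed
  moreover have "nat (c - 1) < N" using c by auto
  ultimately show ?thesis by blast
qed

text \<open>In the four-corner formula the upper corner is at least \<open>1 - 2 * \<delta>\<close>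
  and each mixed corner at most \<delta>, by the Lipschitz bounds. The estimate is the same for all
  copulas.\<close>

lemma measure_copula_inner_square:
  assumes C: "C \<in> copulas" and \<delta>: "0 < \<delta>" "\<delta> < 1 / 2"
  shows "1 - 4 * \<delta> \<le> measure (copula_measure C) ({\<delta><..1 - \<delta>} \<times> {\<delta><..1 - \<delta>})"
proof -
  have "C (1 - \<delta>, 1) - C (1 - \<delta>, 1 - \<delta>) \<le> \<delta>"
    using copula_increment_snd(2)[OF C, of "1 - \<delta>" "1 - \<delta>" 1] \<delta> by auto
  moreover have "C (\<delta>, 1 - \<delta>) - C (0, 1 - \<delta>) \<le> \<delta>"
    using copula_increment_fst(2)[OF C, of 0 \<delta> "1 - \<delta>"] \<delta> by auto
  moreover have "C (1 - \<delta>, \<delta>) - C (1 - \<delta>, 0) \<le> \<delta>"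
    using copula_increment_snd(2)[OF C, of "1 - \<delta>" 0 \<delta>] \<delta> by auto
  moreover have "0 \<le> C (\<delta>, \<delta>)"
    using copula_range[OF C, of "(\<delta>, \<delta>)"] \<delta> by auto
  moreover have "C (1 - \<delta>, 1) = 1 - \<delta>" "C (0, 1 - \<delta>) = 0" "C (1 - \<delta>, 0) = 0"
    using copula_boundary[OF C, of "1 - \<delta>"] \<delta> by auto
  moreover have "measure (copula_measure C) ({\<delta><..1 - \<delta>} \<times> {\<delta><..1 - \<delta>}) =
      C (1 - \<delta>, 1 - \<delta>) - C (\<delta>, 1 - \<delta>) - C (1 - \<delta>, \<delta>) + C (\<delta>, \<delta>)"
    using \<delta> by (intro measure_copula_rectangle[OF C]) auto
  ultimately show ?thesis by linarith
qed

lemma integrable_copula_bounded: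
  assumes C: "C \<in> copulas" and \<phi>: "\<phi> \<in> borel_measurable (restrict_space borel unit_square)"
    and K: "\<And>p. p \<in> unit_square \<Longrightarrow> \<bar>\<phi> p\<bar> \<le> (K::real)"
  shows "integrable (copula_measure C) \<phi>"
proof -
  interpret prob_space "copula_measure C" by (rule prob_space_copula_measure[OF C])
  show ?thesis
    using \<phi> K by (intro integrable_const_bound[of _ K] AE_I2)
      (auto simp: borel_measurable_copula_measure[OF C] space_copula_measure[OF C])
qed

text \<open>Error budget: replacing \<phi> by the step function \<open>g\<close> costs at most
  \<open>e / 4\<close> for each copula, half on the inner square and half on the boundary frame. The
  integrals of \<open>g\<close> differ by at most another \<open>e / 4\<close>.\<close>

lemma integral_copula_uniformly_continuous:
  fixes \<phi> :: "real \<times> real \<Rightarrow> real"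
  assumes meas: "\<phi> \<in> borel_measurable (restrict_space borel unit_square)"
    and K: "\<And>p. p \<in> unit_square \<Longrightarrow> \<bar>\<phi> p\<bar> \<le> K"
    and cont: "continuous_on ({0<..<1} \<times> {0<..<1}) \<phi>"
    and e: "0 < e"
  shows "\<exists>d>0. \<forall>A\<in>copulas. \<forall>B\<in>copulas. copula_dist A B < d \<longrightarrow>
    \<bar>integral\<^sup>L (copula_measure A) \<phi> - integral\<^sup>L (copula_measure B) \<phi>\<bar> < e"
proof -
  have K0: "0 \<le> K" using K[of "(0, 0)"] by auto
  \<comment> \<open>The bound 1/4 keeps the inner square nondegenerate; the other bound makes the
    frame contribute at most \<open>e / 8\<close>. Using \<open>K + 1\<close> covers
    \<open>K = 0\<close>.\<close>
  define \<delta> where "\<delta> = min (1 / 4) (e / (32 * (K + 1)))"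
  have \<delta>: "0 < \<delta>" "\<delta> < 1 / 2" using e K0 by (auto simp: \<delta>_def)
  have "K * (4 * \<delta>) \<le> K * (4 * (e / (32 * (K + 1))))"
    using K0 by (intro mult_left_mono) (auto simp: \<delta>_def)
  also have "\<dots> \<le> e / 8" using K0 e by (simp add: field_simps)
  finally have \<delta>K: "K * (4 * \<delta>) \<le> e / 8" .
  have "uniformly_continuous_on ({\<delta>..1 - \<delta>} \<times> {\<delta>..1 - \<delta>}) \<phi>"
    using \<delta> by (intro compact_uniformly_continuous continuous_on_subset[OF cont] compact_Times) auto
  then obtain \<eta> where \<eta>: "0 < \<eta>"
    "\<And>p q. p \<in> {\<delta>..1 - \<delta>} \<times> {\<delta>..1 - \<delta>} \<Longrightarrow> q \<in> {\<delta>..1 - \<delta>} \<times> {\<delta>..1 - \<delta>} \<Longrightarrow>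
      dist q p < \<eta> \<Longrightarrow> dist (\<phi> q) (\<phi> p) < e / 8"
    unfolding uniformly_continuous_on_def using e by (metis divide_pos_pos zero_less_numeral)
  \<comment> \<open>Chosen so that twice the cell side stays below \<eta>, which bounds the distance
    from a point to the corner of its cell.\<close>
  obtain N :: nat where N: "2 / \<eta> < real N" using reals_Archimedean2 by blast
  have N0: "0 < real N" using N \<eta>(1) by (meson divide_pos_pos less_trans zero_less_numeral)
  define h where "h = (1 - 2 * \<delta>) / real N"
  have h: "0 < h" "real N * h = 1 - 2 * \<delta>" using \<delta> N0 by (auto simp: h_def)
  have "h * 2 \<le> 2 / real N" using \<delta> N0 by (simp add: h_def field_simps)
  also have "\<dots> < \<eta>" using N \<eta>(1) N0 by (simp add: field_simps)
  finally have h\<eta>: "h + h < \<eta>" by simp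
  define t where "t i = \<delta> + real i * h" for i
  have t_le: "t i \<le> 1 - \<delta>" if "i \<le> N" for i
  proof -
    have "real i * h \<le> real N * h" using that h by (intro mult_right_mono) auto
    then show ?thesis using h by (simp add: t_def)
  qed
  have t_ge: "\<delta> \<le> t i" for i using h by (simp add: t_def)
  have t_mono: "t i \<le> t (Suc i)" for i using h by (simp add: t_def algebra_simps)
  have tSuc: "t (Suc i) = t i + h" for i by (simp add: t_def algebra_simps)
  define Q where "Q = {\<delta><..1 - \<delta>} \<times> {\<delta><..1 - \<delta>}"
  define cell where "cell ij = {t (fst ij)<..t (Suc (fst ij))} \<times> {t (snd ij)<..t (Suc (snd ij))}" for ij
  define J where "J = {..<N} \<times> {..<N}"
  \<comment> \<open>\<phi> is sampled at the upper right corner, which for indices in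
    \<open>J\<close> still lies in the closed inner square.\<close>
  define c where "c ij = \<phi> (t (Suc (fst ij)), t (Suc (snd ij)))" for ij
  define g where "g p = (\<Sum>ij\<in>J. c ij * indicator (cell ij) p)" for p
  have finJ: "finite J" by (simp add: J_def)
  have c_bound: "\<bar>c ij\<bar> \<le> K" if "ij \<in> J" for ij
    using that t_le[of "Suc (fst ij)"] t_le[of "Suc (snd ij)"] t_ge[of "Suc (fst ij)"] t_ge[of "Suc (snd ij)"] \<delta>
    unfolding c_def by (intro K) (auto simp: J_def)
  have cell_sub: "cell ij \<subseteq> Q" if "ij \<in> J" for ij
    using that t_le[of "Suc (fst ij)"] t_le[of "Suc (snd ij)"] t_ge[of "fst ij"] t_ge[of "snd ij"]
    by (fastforce simp: J_def cell_def Q_def)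
  have Q_sub: "Q \<subseteq> unit_square" using \<delta> by (auto simp: Q_def)
  have off: "g p = 0" if "p \<notin> Q" for p
    unfolding g_def using that cell_sub by (intro sum.neutral) (auto simp: indicator_def)
  have on: "\<bar>\<phi> p - g p\<bar> \<le> e / 8" if "p \<in> Q" for p
  proof -
    obtain x y where p: "p = (x, y)" by (cases p)
    have x: "\<delta> < x" "x \<le> \<delta> + real N * h" and y: "\<delta> < y" "y \<le> \<delta> + real N * h"
      using that by (auto simp: p Q_def h)
    obtain i where i: "i < N" "\<And>k. x \<in> {t k<..t (Suc k)} \<longleftrightarrow> k = i"
      using ex_grid_index[OF h(1) x] unfolding t_def by blast
    obtain j where j: "j < N" "\<And>k. y \<in> {t k<..t (Suc k)} \<longleftrightarrow> k = j"
      using ex_grid_index[OF h(1) y] unfolding t_def by blast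
    have "p \<in> cell kl \<longleftrightarrow> kl = (i, j)" for kl
      using i(2)[of "fst kl"] j(2)[of "snd kl"] by (cases kl) (auto simp: p cell_def)
    then have "g p = (\<Sum>kl\<in>J. if kl = (i, j) then c kl else 0)"
      unfolding g_def by (intro sum.cong) (auto simp: indicator_def)
    also have "\<dots> = c (i, j)" using i j finJ by (simp add: J_def)
    finally have gp: "g p = \<phi> (t (Suc i), t (Suc j))" by (simp add: c_def)
    have xi: "t i < x" "x \<le> t (Suc i)" and yj: "t j < y" "y \<le> t (Suc j)"
      using i(2)[of i] j(2)[of j] by auto
    have "dist p (t (Suc i), t (Suc j)) \<le> \<bar>x - t (Suc i)\<bar> + \<bar>y - t (Suc j)\<bar>"
      unfolding p dist_prod_def by (simp add: dist_real_def sqrt_sum_squares_le_sum_abs)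
    also have "\<dots> \<le> h + h" using xi yj tSuc[of i] tSuc[of j] by linarith
    also have "\<dots> < \<eta>" by (rule h\<eta>)
    finally have "dist (\<phi> p) (\<phi> (t (Suc i), t (Suc j))) < e / 8"
      using that t_le[of "Suc i"] t_le[of "Suc j"] t_ge[of "Suc i"] t_ge[of "Suc j"] i j
      by (intro \<eta>(2)) (auto simp: Q_def)
    then show ?thesis by (simp add: gp dist_real_def)
  qed
  have approx: "\<bar>\<phi> p - g p\<bar> \<le> e / 8 + K * indicator (unit_square - Q) p" if "p \<in> unit_square" for p
    using on[of p] off[of p] K[OF that] that e by (cases "p \<in> Q") auto
  have cell_sets: "cell ij \<in> sets (copula_measure C)" if "C \<in> copulas" "ij \<in> J" for C ij
  proof -
    have "cell ij \<in> sets borel" unfolding cell_def by (intro borel_Times) auto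
    moreover have "cell ij \<subseteq> unit_square" using cell_sub[OF that(2)] Q_sub by blast
    ultimately show ?thesis
      unfolding sets_copula_measure[OF that(1)]
      by (subst sets_restrict_space_iff) (auto intro!: borel_Times)
  qed
  have step: "\<bar>integral\<^sup>L (copula_measure C) \<phi> - integral\<^sup>L (copula_measure C) g\<bar> \<le> e / 4"
    and g_int: "integral\<^sup>L (copula_measure C) g = (\<Sum>ij\<in>J. c ij * measure (copula_measure C) (cell ij))"
    if C: "C \<in> copulas" for C
  proof -
    interpret prob_space "copula_measure C" by (rule prob_space_copula_measure[OF C])
    have Q: "Q \<in> events" unfolding Q_def using \<delta> by (intro copula_sets[OF C]) auto
    have R: "unit_square - Q \<in> events" using Q sets.compl_sets[OF Q] by (simp add: space_copula_measure[OF C])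
    have int_ind: "integrable (copula_measure C) (indicator X :: _ \<Rightarrow> real)" if "X \<in> events" for X
      using that by (intro integrable_real_indicator) (auto simp: emeasure_eq_measure)
    have g: "integrable (copula_measure C) g"
      unfolding g_def by (intro Bochner_Integration.integrable_sum integrable_mult_right int_ind cell_sets[OF C])
    show "integral\<^sup>L (copula_measure C) g = (\<Sum>ij\<in>J. c ij * prob (cell ij))"
      unfolding g_def using cell_sets[OF C] int_ind
      by (subst Bochner_Integration.integral_sum) (auto simp: sets.Int_space_eq2)
    have \<phi>: "integrable (copula_measure C) \<phi>" by (rule integrable_copula_bounded[OF C meas K])
    have "\<bar>(\<integral>p. \<phi> p \<partial>copula_measure C) - (\<integral>p. g p \<partial>copula_measure C)\<bar> =
        \<bar>\<integral>p. \<phi> p - g p \<partial>copula_measure C\<bar>"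
      using \<phi> g by simp
    also have "\<dots> \<le> (\<integral>p. \<bar>\<phi> p - g p\<bar> \<partial>copula_measure C)"
      by (rule integral_abs_bound)
    also have "\<dots> \<le> (\<integral>p. e / 8 + K * indicator (unit_square - Q) p \<partial>copula_measure C)"
      using \<phi> g int_ind[OF R] approx
      by (intro integral_mono) (auto simp: space_copula_measure[OF C])
    also have "\<dots> = e / 8 + K * prob (unit_square - Q)"
      using int_ind[OF R] R by (simp add: prob_space sets.Int_space_eq2)
    also have "prob (unit_square - Q) = 1 - prob Q"
      using prob_compl[OF Q] by (simp add: space_copula_measure[OF C])
    also have "e / 8 + K * (1 - prob Q) \<le> e / 8 + K * (4 * \<delta>)"
      using measure_copula_inner_square[OF C \<delta>] K0 
      by (intro add_left_mono mult_left_mono) (auto simp: Q_def)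
    also have "\<dots> \<le> e / 4" using \<delta>K by simp
    finally show "\<bar>integral\<^sup>L (copula_measure C) \<phi> - integral\<^sup>L (copula_measure C) g\<bar> \<le> e / 4" .
  qed
  have cell_prob: "measure (copula_measure C) (cell ij) =
      C (t (Suc (fst ij)), t (Suc (snd ij))) - C (t (fst ij), t (Suc (snd ij)))
      - C (t (Suc (fst ij)), t (snd ij)) + C (t (fst ij), t (snd ij))"
    if "C \<in> copulas" "ij \<in> J" for C ij
    unfolding cell_def using that(2) t_ge[of "fst ij"] t_ge[of "snd ij"] t_mono[of "fst ij"] t_mono[of "snd ij"]
      t_le[of "Suc (fst ij)"] t_le[of "Suc (snd ij)"] \<delta>
    by (intro measure_copula_rectangle that(1)) (auto simp: J_def)
  have cell_diff: "\<bar>measure (copula_measure A) (cell ij) - measure (copula_measure B) (cell ij)\<bar> \<le> 4 * copula_dist A B"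
    if A: "A \<in> copulas" and B: "B \<in> copulas" and ij: "ij \<in> J" for A B ij
  proof -
    have t01: "t k \<in> {0..1}" if "k \<le> N" for k using t_le[OF that] t_ge[of k] \<delta> by auto
    have "(t k, t l) \<in> unit_square" if "k \<le> N" "l \<le> N" for k l using t01 that by auto
    then have d: "\<bar>A (t k, t l) - B (t k, t l)\<bar> \<le> copula_dist A B" if "k \<le> N" "l \<le> N" for k l
      using that by (intro copula_dist_upper[OF A B]) auto
    have "fst ij < N" "snd ij < N" using ij by (auto simp: J_def)
    then show ?thesis
      using d[of "Suc (fst ij)" "Suc (snd ij)"] d[of "fst ij" "Suc (snd ij)"]
        d[of "Suc (fst ij)" "snd ij"] d[of "fst ij" "snd ij"]
      unfolding cell_prob[OF A ij] cell_prob[OF B ij] by linarith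
  qed
  \<comment> \<open>Number of cells, times the bound on the coefficients, times the four corner
    values of the copula per cell.\<close>
  define L where "L = real (card J) * (K * 4)"
  have L: "0 \<le> L" using K0 by (simp add: L_def)
  have g_lip: "\<bar>integral\<^sup>L (copula_measure A) g - integral\<^sup>L (copula_measure B) g\<bar> \<le> L * copula_dist A B"
    if A: "A \<in> copulas" and B: "B \<in> copulas" for A B
  proof -
    have "\<bar>integral\<^sup>L (copula_measure A) g - integral\<^sup>L (copula_measure B) g\<bar> =
        \<bar>\<Sum>ij\<in>J. c ij * (measure (copula_measure A) (cell ij) - measure (copula_measure B) (cell ij))\<bar>"
      unfolding g_int[OF A] g_int[OF B] by (simp add: sum_subtractf algebra_simps)
    also have "\<dots> \<le> (\<Sum>ij\<in>J. \<bar>c ij * (measure (copula_measure A) (cell ij) - measure (copula_measure B) (cell ij))\<bar>)"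
      by (rule sum_abs)
    also have "\<dots> \<le> (\<Sum>ij\<in>J. K * (4 * copula_dist A B))"
      unfolding abs_mult using c_bound cell_diff[OF A B] K0 by (intro sum_mono mult_mono) auto
    also have "\<dots> = L * copula_dist A B" by (simp add: L_def)
    finally show ?thesis .
  qed
  show ?thesis
  proof (intro exI[of _ "e / (4 * (L + 1))"] conjI ballI impI)
    show "0 < e / (4 * (L + 1))" using e L by simp
    fix A B assume A: "A \<in> copulas" and B: "B \<in> copulas" and d: "copula_dist A B < e / (4 * (L + 1))"
    have "L * copula_dist A B \<le> L * (e / (4 * (L + 1)))" using L d by (intro mult_left_mono) auto
    also have "\<dots> \<le> e / 4" using L e by (simp add: field_simps)
    finally show "\<bar>integral\<^sup>L (copula_measure A) \<phi> - integral\<^sup>L (copula_measure B) \<phi>\<bar> < e"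
      using step[OF A] step[OF B] g_lip[OF A B] e by linarith
  qed
qed

text \<open>Above: interpolate from the corners along the vertical edges, then horizontally between
  these edges. Below: the centre is the midpoint of a point and its reflection, and the value at the
  reflection is already bounded above.\<close>

lemma convex_on_unit_square_bounded:
  assumes \<phi>: "convex_on unit_square (\<phi> :: real \<times> real \<Rightarrow> real)"
  shows "\<exists>K. \<forall>p\<in>unit_square. \<bar>\<phi> p\<bar> \<le> K"
proof -
  define b where "b = Max (\<phi> ` ({0, 1} \<times> {0, 1}))"
  have corner: "\<phi> (i, j) \<le> b" if "i \<in> {0, 1}" "j \<in> {0, 1}" for i j
    unfolding b_def using that by (intro Max_ge) auto
  have seg: "\<phi> ((1 - s) *\<^sub>R p + s *\<^sub>R q) \<le> c"
    if "p \<in> unit_square" "q \<in> unit_square" "\<phi> p \<le> c" "\<phi> q \<le> c" "s \<in> {0..1}" for p q s c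
  proof -
    have "\<phi> ((1 - s) *\<^sub>R p + s *\<^sub>R q) \<le> (1 - s) * \<phi> p + s * \<phi> q"
      using that by (intro convex_onD[OF \<phi>]) auto
    also have "\<dots> \<le> (1 - s) * c + s * c" using that by (intro add_mono mult_left_mono) auto
    finally show ?thesis by (simp add: algebra_simps)
  qed
  have edge: "\<phi> (i, y) \<le> b" if "i \<in> {0, 1}" "y \<in> {0..1}" for i y
    using seg[of "(i, 0)" "(i, 1)" b y] corner that by (auto simp: algebra_simps)
  have upper: "\<phi> (x, y) \<le> b" if "x \<in> {0..1}" "y \<in> {0..1}" for x y
  proof -
    have "(1 - x) *\<^sub>R (0, y) + x *\<^sub>R (1, y) = (x, y)" by (simp add: algebra_simps)
    then show ?thesis using seg[of "(0, y)" "(1, y)" b x] edge[of 0 y] edge[of 1 y] that by simp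
  qed
  have lower: "2 * \<phi> (1 / 2, 1 / 2) - b \<le> \<phi> (x, y)" if "x \<in> {0..1}" "y \<in> {0..1}" for x y
  proof -
    have "\<phi> ((1 - 1 / 2) *\<^sub>R (x, y) + (1 / 2) *\<^sub>R (1 - x, 1 - y)) \<le>
        (1 - 1 / 2) * \<phi> (x, y) + (1 / 2) * \<phi> (1 - x, 1 - y)"
      using that by (intro convex_onD[OF \<phi>]) auto
    moreover have "(1 - 1 / 2) *\<^sub>R (x, y) + (1 / 2) *\<^sub>R (1 - x, 1 - y) = (1 / 2, 1 / 2)"
      by (simp add: diff_divide_distrib)
    then have "\<phi> (1 / 2, 1 / 2) = \<phi> ((1 - 1 / 2) *\<^sub>R (x, y) + (1 / 2) *\<^sub>R (1 - x, 1 - y))"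
      by (simp only:)
    ultimately show ?thesis using upper[of "1 - x" "1 - y"] that by simp
  qed
  show ?thesis
  proof (intro exI ballI)
    fix p assume "p \<in> unit_square"
    then show "\<bar>\<phi> p\<bar> \<le> \<bar>b\<bar> + \<bar>2 * \<phi> (1 / 2, 1 / 2) - b\<bar>"
      using upper[of "fst p" "snd p"] lower[of "fst p" "snd p"] by auto
  qed
qed

text \<open>Convex functions are continuous on the open square, and the previous lemma bounds them
  on the closed one. Jumps at the boundary are thereby allowed.\<close>

lemma integral_convex_uniformly_continuous:
  assumes \<phi>: "convex_on unit_square \<phi>" and e: "0 < e"
  shows "\<exists>d>0. \<forall>A\<in>copulas. \<forall>B\<in>copulas. copula_dist A B < d \<longrightarrow>
    \<bar>integral\<^sup>L (copula_measure A) \<phi> - integral\<^sup>L (copula_measure B) \<phi>\<bar> < e"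
proof (cases "\<phi> \<in> borel_measurable (restrict_space borel unit_square)")
  case True
  obtain K where "\<And>p. p \<in> unit_square \<Longrightarrow> \<bar>\<phi> p\<bar> \<le> K"
    using convex_on_unit_square_bounded[OF \<phi>] by blast
  moreover have "continuous_on ({0<..<1} \<times> {0<..<1}) \<phi>"
  proof (rule convex_on_continuous)
    show "open ({0<..<1} \<times> {0<..<1} :: (real \<times> real) set)" by (intro open_Times) auto
    show "convex_on ({0<..<1} \<times> {0<..<1}) \<phi>"
      by (rule convex_on_subset[OF \<phi>]) (auto intro!: convex_Times)
  qed
  ultimately show ?thesis using integral_copula_uniformly_continuous[OF True _ _ e] by blast
next
  case False
  \<comment> \<open>The integral of a nonmeasurable function is \<open>0\<close>. Convex functions on the closed square are
    in fact Borel measurable, but this case distinction spares the proof.\<close>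
  have "integral\<^sup>L (copula_measure A) \<phi> = 0" if "A \<in> copulas" for A
    using False that
    by (intro not_integrable_integral_eq) (auto dest!: borel_measurable_integrable simp: borel_measurable_copula_measure)
  then show ?thesis using e by (intro exI[of _ 1]) auto
qed

subsection \<open>Quadratic obstructions to comparability\<close>

lemma measure_unit_uniform_atMost: "measure unit_uniform {..a} = unit_clamp a"
proof -
  have "emeasure unit_uniform {..a} = emeasure lborel ({0..1} \<inter> {..a})"
    by (rule emeasure_unit_uniform) simp
  also have "{0..1} \<inter> {..a} = (if a < 0 then {} else {0..unit_clamp a})"
    by (auto simp: unit_clamp_def)
  also have "emeasure lborel \<dots> = ennreal (unit_clamp a)"
    by (auto simp: unit_clamp_def ennreal_neg)
  finally show ?thesis by (simp add: measure_def)
qed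

lemma measurable_copula_measure:
  assumes "C \<in> copulas" "f \<in> borel_measurable borel"
  shows "f \<in> borel_measurable (copula_measure C)"
  unfolding borel_measurable_copula_measure[OF assms(1)]
  by (rule measurable_restrict_space1[OF assms(2)])

text \<open>Both distribution functions equal \<open>unit_clamp\<close>, by the boundary values
  \<open>C (t, 1) = t\<close> and \<open>C (1, t) = t\<close>.\<close>

lemma copula_marginals:
  assumes C: "C \<in> copulas"
  shows "distr (copula_measure C) borel fst = unit_uniform"
    and "distr (copula_measure C) borel snd = unit_uniform"
proof -
  interpret prob_space "copula_measure C" by (rule prob_space_copula_measure[OF C])
  interpret U: prob_space unit_uniform by (rule prob_space_unit_uniform)
  have U: "real_distribution unit_uniform" by unfold_locales auto
  have fst: "fst \<in> borel_measurable (copula_measure C)" and snd: "snd \<in> borel_measurable (copula_measure C)"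
    by (auto intro!: measurable_copula_measure[OF C] borel_measurable_continuous_onI continuous_intros)
  have "prob (fst -` {..a} \<inter> space (copula_measure C)) = unit_clamp a \<and>
    prob (snd -` {..a} \<inter> space (copula_measure C)) = unit_clamp a" for a
  proof (cases "a < 0")
    case True
    then have "fst -` {..a} \<inter> unit_square = {}" "snd -` {..a} \<inter> unit_square = {}" by auto
    with True show ?thesis by (simp add: space_copula_measure[OF C] unit_clamp_def)
  next
    case False
    then have "fst -` {..a} \<inter> unit_square = {0..unit_clamp a} \<times> {0..1}"
      "snd -` {..a} \<inter> unit_square = {0..1} \<times> {0..unit_clamp a}"
      by (auto simp: unit_clamp_def)
    then show ?thesis
      using copula_boundary[OF C, of "unit_clamp a"]
      by (simp add: space_copula_measure[OF C] measure_copula_measure[OF C])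
  qed
  then have "cdf (distr (copula_measure C) borel fst) = cdf unit_uniform"
    "cdf (distr (copula_measure C) borel snd) = cdf unit_uniform"
    by (auto simp: fun_eq_iff cdf_def measure_distr fst snd measure_unit_uniform_atMost)
  then show "distr (copula_measure C) borel fst = unit_uniform"
    "distr (copula_measure C) borel snd = unit_uniform"
    using fst snd by (auto intro!: cdf_unique real_distribution_distr U)
qed

text \<open>Only \<open>s = -1\<close> and \<open>s = 1\<close> matter in the end: the squares of
  the difference and of the sum of the coordinates.\<close>

definition quad :: "real \<Rightarrow> real \<times> real \<Rightarrow> real" where
  "quad s p = (fst p + s * snd p)\<^sup>2"

lemma quad_measurable: "quad s \<in> borel_measurable borel"
  unfolding quad_def[abs_def] by (intro borel_measurable_continuous_onI continuous_intros)

text \<open>\<open>quad s\<close> is the square of a linear form, and the convexity defect of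
  squaring is \<open>t * (1 - t) * (a - b)\<^sup>2\<close>.\<close>

lemma convex_on_quad: "convex_on unit_square (quad s)"
proof (rule convex_onI)
  fix t :: real and p q :: "real \<times> real" assume t: "0 < t" "t < 1"
  define a b where "a = fst p + s * snd p" and "b = fst q + s * snd q"
  have "(1 - t) * a\<^sup>2 + t * b\<^sup>2 - ((1 - t) * a + t * b)\<^sup>2 = t * (1 - t) * (a - b)\<^sup>2"
    by (simp add: power2_eq_square algebra_simps)
  also have "\<dots> \<ge> 0" using t by simp
  finally have "((1 - t) * a + t * b)\<^sup>2 \<le> (1 - t) * a\<^sup>2 + t * b\<^sup>2" by simp
  moreover have "quad s ((1 - t) *\<^sub>R p + t *\<^sub>R q) = ((1 - t) * a + t * b)\<^sup>2"
    by (simp add: quad_def a_def b_def algebra_simps)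
  ultimately show "quad s ((1 - t) *\<^sub>R p + t *\<^sub>R q) \<le> (1 - t) * quad s p + t * quad s q"
    by (simp add: quad_def a_def b_def)
qed (intro convex_Times convex_real_interval)

lemma quad_bounded:
  assumes "\<bar>s\<bar> \<le> 1" "p \<in> unit_square"
  shows "\<bar>quad s p\<bar> \<le> 4"
proof -
  have "\<bar>s * snd p\<bar> \<le> 1 * 1" unfolding abs_mult using assms by (intro mult_mono) auto
  then have "\<bar>fst p + s * snd p\<bar> \<le> 2" using assms by auto
  then have "\<bar>fst p + s * snd p\<bar>\<^sup>2 \<le> 2\<^sup>2" by (intro power_mono) auto
  then show ?thesis by (simp add: quad_def)
qed

lemma integrable_quad: "C \<in> copulas \<Longrightarrow> \<bar>s\<bar> \<le> 1 \<Longrightarrow> integrable (copula_measure C) (quad s)"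
  using quad_bounded by (intro integrable_copula_bounded[where K=4] measurable_restrict_space1 quad_measurable) auto

text \<open>The two squares add up to twice the sum of the squared coordinates, whose integral
  depends on the uniform marginals alone.\<close>

lemma integral_quad_sum:
  assumes C: "C \<in> copulas"
  shows "integral\<^sup>L (copula_measure C) (quad (-1)) + integral\<^sup>L (copula_measure C) (quad 1) =
    4 * (\<integral>x. x\<^sup>2 \<partial>unit_uniform)"
proof -
  let ?\<mu> = "copula_measure C"
  have fst: "fst \<in> borel_measurable ?\<mu>" and snd: "snd \<in> borel_measurable ?\<mu>"
    by (auto intro!: measurable_copula_measure[OF C] borel_measurable_continuous_onI continuous_intros)
  have int: "integrable ?\<mu> (\<lambda>p. (fst p)\<^sup>2)" "integrable ?\<mu> (\<lambda>p. (snd p)\<^sup>2)"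
    by (auto intro!: integrable_copula_bounded[OF C, where K=1] measurable_restrict_space1
      borel_measurable_continuous_onI continuous_intros power_le_one)
  have "integral\<^sup>L ?\<mu> (quad (-1)) + integral\<^sup>L ?\<mu> (quad 1) = (\<integral>p. quad (-1) p + quad 1 p \<partial>?\<mu>)"
    using integrable_quad[OF C] by simp
  also have "\<dots> = (\<integral>p. 2 * (fst p)\<^sup>2 + 2 * (snd p)\<^sup>2 \<partial>?\<mu>)"
    by (intro Bochner_Integration.integral_cong) (auto simp: quad_def power2_eq_square algebra_simps)
  also have "\<dots> = 2 * (\<integral>p. (fst p)\<^sup>2 \<partial>?\<mu>) + 2 * (\<integral>p. (snd p)\<^sup>2 \<partial>?\<mu>)"
    using int by simp
  also have "(\<integral>p. (fst p)\<^sup>2 \<partial>?\<mu>) = (\<integral>x. x\<^sup>2 \<partial>distr ?\<mu> borel fst)"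
    by (rule integral_distr[symmetric, OF fst]) simp
  also have "(\<integral>p. (snd p)\<^sup>2 \<partial>?\<mu>) = (\<integral>x. x\<^sup>2 \<partial>distr ?\<mu> borel snd)"
    by (rule integral_distr[symmetric, OF snd]) simp
  finally show ?thesis unfolding copula_marginals[OF C] by simp
qed

text \<open>Comparability moves both quadratic integrals in the same direction while their sum is
  fixed, so neither can change.\<close>

lemma P_cx_imp_integral_quad_eq:
  assumes "(A, B) \<in> P_cx"
  shows "integral\<^sup>L (copula_measure A) (quad (-1)) = integral\<^sup>L (copula_measure B) (quad (-1))"
proof -
  have A: "A \<in> copulas" and B: "B \<in> copulas" and cx: "A \<le>\<^sub>c\<^sub>x B \<or> B \<le>\<^sub>c\<^sub>x A"
    using assms by (auto simp: P_cx_def)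
  have mono: "integral\<^sup>L (copula_measure C) (quad s) \<le> integral\<^sup>L (copula_measure D) (quad s)"
    if "C \<le>\<^sub>c\<^sub>x D" for C D s
    using that convex_on_quad by (auto simp: cx_le_def)
  from cx show ?thesis
    using mono[of A B "-1"] mono[of A B 1] mono[of B A "-1"] mono[of B A 1]
      integral_quad_sum[OF A] integral_quad_sum[OF B]
    by linarith
qed

section \<open>Convex combinations of copulas\<close>

definition copula_mix :: "real \<Rightarrow> (real \<times> real \<Rightarrow> real) \<Rightarrow> (real \<times> real \<Rightarrow> real) \<Rightarrow> real \<times> real \<Rightarrow> real" where
  "copula_mix s A B = restrict (\<lambda>p. (1 - s) * A p + s * B p) unit_square"

lemma copula_mix_copula:
  assumes A: "A \<in> copulas" and B: "B \<in> copulas" and s: "s \<in> {0..1}"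
  shows "copula_mix s A B \<in> copulas"
proof -
  have range: "copula_mix s A B p \<in> {0..1}" if "p \<in> unit_square" for p
  proof -
    have "(1 - s) * A p + s * B p \<le> (1 - s) * 1 + s * 1"
      using copula_range[OF A that] copula_range[OF B that] s by (intro add_mono mult_left_mono) auto
    then show ?thesis
      using copula_range[OF A that] copula_range[OF B that] s that by (auto simp: copula_mix_def)
  qed
  have rect: "0 \<le> copula_mix s A B (u', v') - copula_mix s A B (u, v') - copula_mix s A B (u', v) + copula_mix s A B (u, v)"
    if uv: "u \<in> {0..1}" "u' \<in> {0..1}" "v \<in> {0..1}" "v' \<in> {0..1}" "u \<le> u'" "v \<le> v'" for u u' v v'
  proof -
    have "0 \<le> (1 - s) * (A (u', v') - A (u, v') - A (u', v) + A (u, v)) +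
        s * (B (u', v') - B (u, v') - B (u', v) + B (u, v))"
      using mult_nonneg_nonneg[OF _ copula_rectangle[OF A uv], of "1 - s"]
        mult_nonneg_nonneg[OF _ copula_rectangle[OF B uv], of s] s by simp
    then show ?thesis using uv by (simp add: copula_mix_def algebra_simps)
  qed
  show ?thesis
    unfolding copulas_def
  proof (intro CollectI conjI)
    show "copula_mix s A B \<in> unit_square \<rightarrow>\<^sub>E {0..1}"
      using range by (auto simp: PiE_iff copula_mix_def)
    show "\<forall>t\<in>{0..1}. copula_mix s A B (t, 0) = 0 \<and> copula_mix s A B (0, t) = 0 \<and>
        copula_mix s A B (t, 1) = t \<and> copula_mix s A B (1, t) = t"
      using copula_boundary[OF A] copula_boundary[OF B] by (auto simp: copula_mix_def algebra_simps)
  qed (use rect in auto)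
qed

text \<open>Draw from \<open>B\<close> with probability \<open>s\<close> and from \<open>A\<close>
  otherwise. The resulting measure represents the mixture, hence is its copula measure by
  uniqueness, and its integrals are averages of the two.\<close>

lemma integral_copula_mix:
  assumes A: "A \<in> copulas" and B: "B \<in> copulas" and s: "s \<in> {0..1}"
    and meas: "\<phi> \<in> borel_measurable (restrict_space borel unit_square)"
    and K: "\<And>p. p \<in> unit_square \<Longrightarrow> \<bar>\<phi> p\<bar> \<le> (K::real)"
  shows "integral\<^sup>L (copula_measure (copula_mix s A B)) \<phi> =
    (1 - s) * integral\<^sup>L (copula_measure A) \<phi> + s * integral\<^sup>L (copula_measure B) \<phi>"
proof -
  let ?S = "restrict_space borel unit_square :: (real \<times> real) measure"
  let ?N = "\<lambda>b. if b then copula_measure B else copula_measure A"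
  let ?P = "measure_pmf (bernoulli_pmf s)"
  interpret A: prob_space "copula_measure A" by (rule prob_space_copula_measure[OF A])
  interpret B: prob_space "copula_measure B" by (rule prob_space_copula_measure[OF B])
  have N: "?N \<in> measurable ?P (subprob_algebra ?S)"
    by (auto simp: space_subprob_algebra sets_copula_measure A B A.subprob_space_axioms B.subprob_space_axioms)
  have "represents_copula (?P \<bind> ?N) (copula_mix s A B)"
    unfolding represents_copula_def
  proof (intro conjI ballI)
    show "prob_space (?P \<bind> ?N)"
      using N by (intro measure_pmf.prob_space_bind) (auto simp: A.prob_space_axioms B.prob_space_axioms)
    show "sets (?P \<bind> ?N) = sets ?S"
      by (rule sets_bind) (auto simp: sets_copula_measure A B)
    fix x y :: real assume xy: "x \<in> {0..1}" "y \<in> {0..1}"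
    then have "{0..x} \<times> {0..y} \<in> sets ?S"
      using copula_sets[OF A, of "{0..x}" "{0..y}"] by (simp add: sets_copula_measure[OF A])
    then have "measure (?P \<bind> ?N) ({0..x} \<times> {0..y}) = (\<integral>b. measure (?N b) ({0..x} \<times> {0..y}) \<partial>?P)"
      by (intro measure_pmf.measure_bind[OF N])
    also have "\<dots> = copula_mix s A B (x, y)"
      using s xy by (simp add: copula_mix_def measure_copula_measure A B)
    finally show "measure (?P \<bind> ?N) ({0..x} \<times> {0..y}) = copula_mix s A B (x, y)" .
  qed
  then have "integral\<^sup>L (copula_measure (copula_mix s A B)) \<phi> = integral\<^sup>L (?P \<bind> ?N) \<phi>"
    by (simp add: copula_measure_eqI)
  also have "\<dots> = (\<integral>b. integral\<^sup>L (?N b) \<phi> \<partial>?P)"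
    using K by (intro integral_bind[OF meas _ N, where B=K and B'=1])
      (auto simp: space_restrict_space A.emeasure_space_1 B.emeasure_space_1 measure_pmf.finite_measure_axioms)
  also have "\<dots> = (1 - s) * integral\<^sup>L (copula_measure A) \<phi> + s * integral\<^sup>L (copula_measure B) \<phi>"
    using s by simp
  finally show ?thesis .
qed

lemma copula_dist_mix:
  assumes A: "A \<in> copulas" and B: "B \<in> copulas" and s: "s \<in> {0..1}"
  shows "copula_dist A (copula_mix s A B) \<le> s"
proof (rule copula_dist_least[OF A copula_mix_copula[OF A B s]])
  fix p assume p: "p \<in> unit_square"
  have "A p - copula_mix s A B p = s * (A p - B p)"
    using p by (simp add: copula_mix_def algebra_simps)
  then have "\<bar>A p - copula_mix s A B p\<bar> = s * \<bar>A p - B p\<bar>"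
    using s by (simp add: abs_mult)
  also have "\<dots> \<le> s * 1"
    using copula_range[OF A p] copula_range[OF B p] s by (intro mult_left_mono) auto
  finally show "\<bar>A p - copula_mix s A B p\<bar> \<le> s" by simp
qed

section \<open>Two copulas separated by the quadratic functional\<close>

text \<open>The comonotone copula, also known as the upper Frechet-Hoeffding bound.\<close>

definition min_copula :: "real \<times> real \<Rightarrow> real" where
  "min_copula = restrict (\<lambda>(x, y). min x y) unit_square"

text \<open>The independence copula.\<close>

definition product_copula :: "real \<times> real \<Rightarrow> real" where
  "product_copula = restrict (\<lambda>(x, y). x * y) unit_square"

lemma min_copula: "min_copula \<in> copulas"
  unfolding copulas_def by (auto simp: min_copula_def PiE_iff min_def)

lemma product_copula: "product_copula \<in> copulas"
proof -
  have "0 \<le> u' * v' - u * v' - u' * v + u * v" if "u \<le> u'" "v \<le> v'" for u u' v v' :: real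
  proof -
    have "0 \<le> (u' - u) * (v' - v)" using that by simp
    then show ?thesis by (simp add: algebra_simps)
  qed
  then show ?thesis
    unfolding copulas_def by (auto simp: product_copula_def PiE_iff mult_le_one)
qed

text \<open>The measure is the law of \<open>(X, X)\<close> with \<open>X\<close> uniform, and
  \<open>quad (-1)\<close> vanishes on the diagonal.\<close>

lemma integral_quad_min_copula: "integral\<^sup>L (copula_measure min_copula) (quad (-1)) = 0"
proof -
  let ?S = "restrict_space borel unit_square :: (real \<times> real) measure"
  let ?T = "\<lambda>x. (unit_clamp x, unit_clamp x)"
  interpret U: prob_space unit_uniform by (rule prob_space_unit_uniform)
  have T: "?T \<in> measurable unit_uniform ?S"
    by (rule measurable_restrict_space2) (auto intro!: borel_measurable_Pair)
  have "measure (distr unit_uniform ?S ?T) ({0..x} \<times> {0..y}) = min x y"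
    if xy: "x \<in> {0..1}" "y \<in> {0..1}" for x y
  proof -
    have S: "{0..x} \<times> {0..y} \<in> sets ?S"
      using copula_sets[OF min_copula, of "{0..x}" "{0..y}"] xy by (simp add: sets_copula_measure[OF min_copula])
    have "emeasure (distr unit_uniform ?S ?T) ({0..x} \<times> {0..y}) =
        emeasure unit_uniform (?T -` ({0..x} \<times> {0..y}) \<inter> space unit_uniform)"
      by (rule emeasure_distr[OF T S])
    also have "\<dots> = emeasure lborel ({0..1} \<inter> (?T -` ({0..x} \<times> {0..y}) \<inter> space unit_uniform))"
      using measurable_sets[OF T S] by (intro emeasure_unit_uniform) simp
    also have "{0..1} \<inter> (?T -` ({0..x} \<times> {0..y}) \<inter> space unit_uniform) = {0..min x y}"
      using xy by auto
    finally show ?thesis using xy by (simp add: measure_def)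
  qed
  then have "represents_copula (distr unit_uniform ?S ?T) min_copula"
    using U.prob_space_distr[OF T] by (auto simp: represents_copula_def min_copula_def)
  then have "copula_measure min_copula = distr unit_uniform ?S ?T" by (rule copula_measure_eqI)
  then show ?thesis
    by (simp add: integral_distr[OF T] measurable_restrict_space1[OF quad_measurable]) (simp add: quad_def)
qed

text \<open>A zero integral would concentrate the measure on the diagonal. Then the lower left
  quarter and the left half of the square would have equal mass, but these are 1/4 and 1/2.\<close>

lemma integral_quad_product_copula: "integral\<^sup>L (copula_measure product_copula) (quad (-1)) \<noteq> 0"
proof
  let ?\<mu> = "copula_measure product_copula"
  interpret prob_space ?\<mu> by (rule prob_space_copula_measure[OF product_copula])
  assume "integral\<^sup>L ?\<mu> (quad (-1)) = 0"
  then have "AE p in ?\<mu>. quad (-1) p = 0"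
    by (subst (asm) integral_nonneg_eq_0_iff_AE) (auto simp: integrable_quad[OF product_copula] quad_def)
  then have "AE p in ?\<mu>. p \<in> {0..1/2} \<times> {0..1/2} \<longleftrightarrow> p \<in> {0..1/2} \<times> {0..1}"
    using AE_space by eventually_elim (auto simp: quad_def)
  then have "prob ({0..1/2} \<times> {0..1/2}) = prob ({0..1/2} \<times> {0..1})"
    by (rule finite_measure_eq_AE) (auto intro!: copula_sets[OF product_copula])
  then show False
    by (simp add: measure_copula_measure[OF product_copula]) (simp add: product_copula_def)
qed

text \<open>The functional is affine along mixtures, so any positive weight on a copula with a
  different value changes it, and a small weight moves \<open>A\<close> only slightly.\<close>

lemma perturb_copula:
  assumes A: "A \<in> copulas" and r: "0 < r"
  shows "\<exists>A'\<in>copulas. copula_dist A A' < r \<and>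
    integral\<^sup>L (copula_measure A') (quad (-1)) \<noteq> integral\<^sup>L (copula_measure A) (quad (-1))"
proof -
  let ?J = "\<lambda>C. integral\<^sup>L (copula_measure C) (quad (-1))"
  \<comment> \<open>The functional differs between the two example copulas, so at least one of them
    differs from \<open>A\<close>.\<close>
  obtain D where D: "D \<in> copulas" "?J D \<noteq> ?J A"
    using min_copula product_copula integral_quad_min_copula integral_quad_product_copula by metis
  define s where "s = min 1 (r / 2)"
  have s: "s \<in> {0..1}" "0 < s" "s < r" using r by (auto simp: s_def)
  have "?J (copula_mix s A D) = (1 - s) * ?J A + s * ?J D"
    using quad_bounded by (intro integral_copula_mix[OF A D(1) s(1), where K=4] measurable_restrict_space1 quad_measurable) auto
  then have "?J (copula_mix s A D) - ?J A = s * (?J D - ?J A)" by (simp add: algebra_simps)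
  then have "?J (copula_mix s A D) \<noteq> ?J A" using s D by auto
  then show ?thesis
    using copula_dist_mix[OF A D(1) s(1)] copula_mix_copula[OF A D(1) s(1)] s by force
qed

section \<open>Topological conclusions\<close>

text \<open>One convex function witnesses the failure. If each of its two integrals moves by less
  than half the gap, the strict inequality survives.\<close>

lemma not_cx_le_nhd:
  assumes A: "A \<in> copulas" and B: "B \<in> copulas" and AB: "\<not> A \<le>\<^sub>c\<^sub>x B"
  shows "\<exists>r>0. \<forall>A'\<in>copulas. \<forall>B'\<in>copulas. copula_dist A A' < r \<longrightarrow> copula_dist B B' < r \<longrightarrow> \<not> A' \<le>\<^sub>c\<^sub>x B'"
proof -
  let ?I = "\<lambda>C \<phi>. integral\<^sup>L (copula_measure C) \<phi>"
  obtain \<phi> where \<phi>: "convex_on unit_square \<phi>" "?I B \<phi> < ?I A \<phi>"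
    using AB by (auto simp: cx_le_def not_le)
  define e where "e = (?I A \<phi> - ?I B \<phi>) / 2"
  have "0 < e" using \<phi> by (simp add: e_def)
  from integral_convex_uniformly_continuous[OF \<phi>(1) this]
  obtain r where r: "0 < r" "\<And>C D. C \<in> copulas \<Longrightarrow> D \<in> copulas \<Longrightarrow> copula_dist C D < r \<Longrightarrow> \<bar>?I C \<phi> - ?I D \<phi>\<bar> < e"
    by blast
  have "\<not> A' \<le>\<^sub>c\<^sub>x B'"
    if "A' \<in> copulas" "B' \<in> copulas" "copula_dist A A' < r" "copula_dist B B' < r" for A' B'
  proof -
    have "?I B' \<phi> < ?I A' \<phi>"
      using r(2)[OF A that(1,3)] r(2)[OF B that(2,4)] unfolding e_def by argo
    with \<phi>(1) show ?thesis by (auto simp: cx_le_def not_le)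
  qed
  with r(1) show ?thesis by blast
qed

theorem proposition9:
  shows "closedin copula_pair_topology P_cx \<and> nowhere_dense_in copula_pair_topology P_cx"
proof -
  interpret Metric_space "copulas \<times> copulas" copula_pair_dist by (rule Metric_space_copula_pairs)
  interpret C: Metric_space copulas copula_dist by (rule Metric_space_copulas)
  have pair_ball: "(A', B') \<in> mball (A, B) r \<longleftrightarrow> A \<in> copulas \<and> B \<in> copulas \<and>
      A' \<in> copulas \<and> B' \<in> copulas \<and> copula_dist A A' < r \<and> copula_dist B B' < r" for A B A' B' r
    unfolding in_mball by (auto simp: copula_pair_dist_def)
  have closed: "closedin copula_pair_topology P_cx"
    unfolding copula_pair_topology_def closedin_metric
  proof (intro conjI allI impI)
    show "P_cx \<subseteq> copulas \<times> copulas" by (auto simp: P_cx_def)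
    fix x assume "x \<in> copulas \<times> copulas - P_cx"
    then obtain A B where x: "x = (A, B)" and A: "A \<in> copulas" and B: "B \<in> copulas"
      and AB: "\<not> A \<le>\<^sub>c\<^sub>x B" and BA: "\<not> B \<le>\<^sub>c\<^sub>x A"
      by (auto simp: P_cx_def)
    obtain r where r: "0 < r" "\<And>A' B'. A' \<in> copulas \<Longrightarrow> B' \<in> copulas \<Longrightarrow>
        copula_dist A A' < r \<Longrightarrow> copula_dist B B' < r \<Longrightarrow> \<not> A' \<le>\<^sub>c\<^sub>x B'"
      using not_cx_le_nhd[OF A B AB] by blast
    obtain r' where r': "0 < r'" "\<And>A' B'. A' \<in> copulas \<Longrightarrow> B' \<in> copulas \<Longrightarrow>
        copula_dist A A' < r' \<Longrightarrow> copula_dist B B' < r' \<Longrightarrow> \<not> B' \<le>\<^sub>c\<^sub>x A'"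
      using not_cx_le_nhd[OF B A BA] by blast
    have "disjnt P_cx (mball x (min r r'))"
      using r(2) r'(2) by (auto simp: disjnt_iff x P_cx_def pair_ball simp del: in_mball)
    with r(1) r'(1) show "\<exists>r>0. disjnt P_cx (mball x r)" by (intro exI[of _ "min r r'"]) auto
  qed
  \<comment> \<open>Move only the first component of a pair in \<open>U\<close>. Both the old and
    the new pair would be comparable, so \<open>A\<close> and \<open>A'\<close> would share the
    quadratic integral of \<open>B\<close>, against the choice of \<open>A'\<close>.\<close>
  have "U = {}" if U: "openin copula_pair_topology U" "U \<subseteq> P_cx" for U
  proof (rule ccontr)
    assume "U \<noteq> {}"
    then obtain A B where AB: "(A, B) \<in> U" by auto
    then have P: "(A, B) \<in> P_cx" and A: "A \<in> copulas" and B: "B \<in> copulas"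
      using U(2) by (auto simp: P_cx_def)
    obtain r where r: "0 < r" "mball (A, B) r \<subseteq> U"
      using U(1) AB unfolding copula_pair_topology_def openin_mtopology by blast
    obtain A' where A': "A' \<in> copulas" "copula_dist A A' < r"
      "integral\<^sup>L (copula_measure A') (quad (-1)) \<noteq> integral\<^sup>L (copula_measure A) (quad (-1))"
      using perturb_copula[OF A r(1)] by blast
    have "(A', B) \<in> mball (A, B) r"
      using A A' B r(1) C.mdist_zero[OF B] by (simp add: pair_ball del: in_mball)
    then have "(A', B) \<in> P_cx" using r(2) U(2) by blast
    then show False
      using P A'(3) P_cx_imp_integral_quad_eq by metis
  qed
  then have "copula_pair_topology interior_of P_cx = {}"
    by (auto simp: interior_of_eq_empty)
  \<comment> \<open>A closed set is its own closure, so empty interior already gives nowhere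
    density.\<close>
  with closed show ?thesis
    by (simp add: nowhere_dense_in_def closedin_subset closure_of_closedin)
qed

end
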